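(* Let $\mathcal{L} \subset \mathbb{P}^{2}_{\mathbb{C}}$ be a free arrangement of $d\geq 4$ lines such that $m(\mathcal{L})=4$. Then $$\frac{(d-1)(d-3)}{4} \leq n_{3}+3n_{4}.$$
   Context: We work over $\mathbb{C}$. An arrangement of $d$ lines $\mathcal{L}\subset\mathbb{P}^2$ is a set of $d$ distinct lines, identified with the reduced curve $\{f=0\}$ that is their union. For $r\ge 2$, $n_r$ denotes the number of points of $\mathbb{P}^2$ lying on exactly $r$ lines of $\mathcal{L}$, and the maximal multiplicity is $m(\mathcal{L})=\max\{r: n_r\neq 0\}$. Let $S=\mathbb{C}[x,y,z]$ and $AR(f)=\{(a,b,c)\in S^3: af_x+bf_y+cf_z=0\}$, a graded $S$-module. The arrangement $\mathcal{L}$ is free if $AR(f)$ is a free graded $S$-module of rank $2$. *)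

theory Defs
  imports
    "HOL-Analysis.Analysis"
    "HOL-Computational_Algebra.Computational_Algebra"
begin

section \<open>The polynomial ring in three variables and its graded module of triples\<close>

text \<open>
  \<open>\<complex>[x,y,z]\<close> is represented as \<open>\<complex>[x][y][z]\<close>: the outermost polynomial variable is \<open>z\<close>, the
  innermost one is \<open>x\<close>.
\<close>

type_synonym S = "complex poly poly poly"

definition const :: "complex \<Rightarrow> S" where
  "const c = [:[:[:c:]:]:]"

definition var_x :: S where "var_x = [:[:[:0, 1:]:]:]"
definition var_y :: S where "var_y = [:[:0, 1:]:]"
definition var_z :: S where "var_z = [:0, 1:]"

definition partial_x :: "S \<Rightarrow> S" where "partial_x f = map_poly (map_poly pderiv) f"
definition partial_y :: "S \<Rightarrow> S" where "partial_y f = map_poly pderiv f"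
definition partial_z :: "S \<Rightarrow> S" where "partial_z f = pderiv f"

text \<open>\<open>coeff (coeff (coeff p k) j) i\<close> is the coefficient of \<open>x\<^sup>i y\<^sup>j z\<^sup>k\<close>; the zero polynomial is
  homogeneous of every degree.\<close>

definition homogeneous :: "nat \<Rightarrow> S \<Rightarrow> bool" where
  "homogeneous n p \<longleftrightarrow>
     (\<forall>i j k. coeff (coeff (coeff p k) j) i \<noteq> 0 \<longrightarrow> i + j + k = n)"

definition homogeneous_vec :: "nat \<Rightarrow> S ^ 3 \<Rightarrow> bool" where
  "homogeneous_vec n r \<longleftrightarrow> (\<forall>i. homogeneous n (r $ i))"

interpretation S3: module "(*s) :: S \<Rightarrow> S ^ 3 \<Rightarrow> S ^ 3"
  by unfold_locales (simp_all add: vec_eq_iff algebra_simps)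

definition AR :: "S \<Rightarrow> (S ^ 3) set" where
  "AR f = {r. r $ 1 * partial_x f + r $ 2 * partial_y f + r $ 3 * partial_z f = 0}"

text \<open>
  A graded submodule \<open>M\<close> of \<open>S\<^sup>3\<close> is a free graded module of rank \<open>n\<close>, that is
  \<open>M \<cong> S(-d\<^sub>1) \<oplus> \<dots> \<oplus> S(-d\<^sub>n)\<close>, iff it has a basis of \<open>n\<close> homogeneous elements.
\<close>

definition free_graded_of_rank :: "nat \<Rightarrow> (S ^ 3) set \<Rightarrow> bool" where
  "free_graded_of_rank n M \<longleftrightarrow>
     (\<exists>B. finite B \<and> card B = n \<and> (\<forall>b\<in>B. \<exists>k. homogeneous_vec k b) \<and>
          S3.independent B \<and> S3.span B = M)"

section \<open>Line arrangements in the complex projective plane\<close>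

definition proj_plane :: "(complex ^ 3) set set" where
  "proj_plane = {P. vec.subspace P \<and> vec.dim P = 1}"

definition proj_line :: "complex ^ 3 \<Rightarrow> (complex ^ 3) set set" where
  "proj_line a = {P \<in> proj_plane. \<forall>v\<in>P. a $ 1 * v $ 1 + a $ 2 * v $ 2 + a $ 3 * v $ 3 = 0}"

definition linear_form :: "complex ^ 3 \<Rightarrow> S" where
  "linear_form a = const (a $ 1) * var_x + const (a $ 2) * var_y + const (a $ 3) * var_z"

definition line_arrangement :: "(complex ^ 3) set set set \<Rightarrow> bool" where
  "line_arrangement L \<longleftrightarrow> finite L \<and> L \<subseteq> {proj_line a | a. a \<noteq> 0}"

text \<open>
  The reduced curve that is the union of the lines is given by the product of one linear equation
  per line; such an \<open>f\<close> is determined up to a nonzero constant factor.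
\<close>

definition defining_equation :: "(complex ^ 3) set set set \<Rightarrow> S \<Rightarrow> bool" where
  "defining_equation L f \<longleftrightarrow>
     (\<exists>a. (\<forall>l\<in>L. a l \<noteq> 0 \<and> proj_line (a l) = l) \<and> f = (\<Prod>l\<in>L. linear_form (a l)))"

definition free_arrangement :: "(complex ^ 3) set set set \<Rightarrow> bool" where
  "free_arrangement L \<longleftrightarrow>
     line_arrangement L \<and> (\<exists>f. defining_equation L f \<and> free_graded_of_rank 2 (AR f))"

text \<open>Only meaningful for \<open>r \<ge> 2\<close>: for smaller \<open>r\<close> the set may be infinite, with \<open>card\<close> equal to
  \<open>0\<close>.\<close>

definition num_points :: "(complex ^ 3) set set set \<Rightarrow> nat \<Rightarrow> nat" where
  "num_points L r = card {P \<in> proj_plane. card {l \<in> L. P \<in> l} = r}"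

text \<open>The maximum is over a nonempty set as soon as \<open>L\<close> has at least two lines.\<close>

definition max_multiplicity :: "(complex ^ 3) set set set \<Rightarrow> nat" where
  "max_multiplicity L = Max {r. 2 \<le> r \<and> num_points L r \<noteq> 0}"

end

theory Submission
  imports Defs
begin

text \<open>
  The proof counts dimensions of spaces of polynomial vector fields of a large degree \<open>N\<close>. Write
  \<open>s(N) = (N + 1)(N + 2) / 2\<close> for the dimension of \<open>S\<^sub>N\<close>, let \<open>f\<close> be the product of the linear forms
  \<open>\<alpha>\<^sub>l\<close> of the lines, read a triple \<open>\<theta>\<close> of forms as the vector field
  \<open>\<theta>\<^sub>1 \<partial>\<^sub>x + \<theta>\<^sub>2 \<partial>\<^sub>y + \<theta>\<^sub>3 \<partial>\<^sub>z\<close>, and let \<open>D\<^sub>N\<close> be the space of the fields of degree \<open>N\<close> that are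
  tangent to all the lines, which means that \<open>\<theta>(\<alpha>\<^sub>l)\<close> vanishes on \<open>l\<close>. Put
  \<open>T = \<Sum>\<^sub>P (r\<^sub>P - 1 choose 2)\<close>, where \<open>r\<^sub>P\<close> is the number of lines through \<open>P\<close>; if no point lies on
  more than four lines, then \<open>T = n\<^sub>3 + 3 n\<^sub>4\<close>.

  Upper bound for \<open>D\<^sub>N\<close>. Add the lines one by one. If \<open>A\<close> is a set of \<open>m\<close> lines that meet a new line
  \<open>H\<close> in \<open>k\<close> points, then the fields tangent to \<open>A\<close> that are also tangent to \<open>H\<close> form the kernel of
  \<open>\<theta> \<mapsto> \<theta>(\<alpha>\<^sub>H)|\<^sub>H\<close>. Its image contains all multiples of \<open>\<Prod>\<^sub>A \<alpha>\<close> of degree \<open>N\<close>, and for each \<open>l\<close> in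
  \<open>A\<close> the multiples of \<open>\<Prod>\<^bsub>A - {l}\<^esub> \<alpha>\<close>, which come from constant fields along the line \<open>l\<close>. On \<open>H\<close>
  these span at least \<open>N + 1 - m + k\<close> dimensions (lemmas \<open>dim_ge_products_of_linear_factors\<close> and \<open>dim_Der_insert\<close>).
  At the same time \<open>T\<close> grows by at least \<open>m - k\<close> (lemma \<open>excess_insert\<close>). Therefore
  \<open>dim D\<^sub>N \<le> 3 s(N) - d (N + 1) + T\<close>.

  Comparison with \<open>AR(f)\<close>. The space \<open>AR(f)\<^sub>N\<close> is contained in \<open>D\<^sub>N\<close>, and it meets the multiples
  \<open>S\<^bsub>N-1\<^esub> \<theta>\<^sub>E\<close> of the Euler field trivially, because \<open>\<theta>\<^sub>E(f) = d f\<close>; hence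
  \<open>dim AR(f)\<^sub>N + s(N - 1) \<le> dim D\<^sub>N\<close>. Moreover \<open>AR(f)\<^sub>N\<close> is the kernel of a map from \<open>S\<^sub>N\<^sup>3\<close> to
  \<open>S\<^bsub>N+d-1\<^esub>\<close>; hence \<open>dim AR(f)\<^sub>N \<ge> 3 s(N) - s(N + d - 1)\<close>. If \<open>AR(f)\<close> is free on generators of
  degrees \<open>a\<close> and \<open>b\<close>, then \<open>dim AR(f)\<^sub>N = s(N - a) + s(N - b)\<close>. All these are polynomials in \<open>N\<close>
  with the same quadratic term. The linear terms of the two inequalities give \<open>a + b = d - 1\<close>, and
  the constant term of the first one gives \<open>a\<^sup>2 + b\<^sup>2 \<le> 2 T + d - 1\<close>. Since
  \<open>(a + b)\<^sup>2 \<le> 2 (a\<^sup>2 + b\<^sup>2)\<close>, this is the bound \<open>(d - 1)(d - 3) \<le> 4 T\<close>.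
\<close>

section \<open>Dimensions of finitely spanned subspaces\<close>

context vector_space begin

text \<open>
  \<open>dim\<close> takes the value \<open>0\<close> on subspaces of infinite dimension, and the ambient spaces below are
  infinite-dimensional, so the dimension estimates rely on this finiteness condition.
\<close>

definition finitely_spanned :: "'b set \<Rightarrow> bool" where
  "finitely_spanned V \<longleftrightarrow> (\<exists>W. finite W \<and> V \<subseteq> local.span W)"

lemma finitely_spanned_subset: "local.finitely_spanned W \<Longrightarrow> V \<subseteq> W \<Longrightarrow> local.finitely_spanned V"
  unfolding local.finitely_spanned_def by blast

lemma finitely_spanned_independent:
  assumes "local.finitely_spanned V" "B \<subseteq> V" "independent B"
  shows "finite B" "card B \<le> local.dim V"
proof -
  obtain W where W: "finite W" "V \<subseteq> local.span W"
    using assms(1) unfolding local.finitely_spanned_def by blast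
  obtain C where C: "B \<subseteq> C" "C \<subseteq> V" "independent C" "V \<subseteq> local.span C"
    using maximal_independent_subset_extend[OF assms(2,3)] by blast
  have "finite C"
    using independent_span_bound[OF W(1) C(3)] C(2) W(2) by blast
  then show "finite B" using C(1) finite_subset by blast
  have "card C = local.dim V" by (rule basis_card_eq_dim[OF C(2,4,3)])
  then show "card B \<le> local.dim V" using card_mono[OF \<open>finite C\<close> C(1)] by simp
qed

lemma dim_mono_finitely_spanned:
  assumes "local.finitely_spanned W" "V \<subseteq> W"
  shows "local.dim V \<le> local.dim W"
proof -
  obtain B where B: "B \<subseteq> V" "independent B" "V \<subseteq> local.span B" "card B = local.dim V"
    by (rule basis_exists)
  then show ?thesis
    using local.finitely_spanned_independent(2)[OF assms(1) _ B(2)] assms(2) by simp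
qed

text \<open>
  A family is linearly independent if linear functionals separate its members from each other,
  since the \<open>i\<close>-th functional reads off the \<open>i\<close>-th coefficient of a linear relation, up to a
  nonzero factor.
\<close>

lemma dual_family_card_le_dim:
  assumes fs: "local.finitely_spanned V" and fin: "finite I"
    and w: "\<And>i. i \<in> I \<Longrightarrow> w i \<in> V"
    and lin: "\<And>i. i \<in> I \<Longrightarrow> Vector_Spaces.linear scale (*) (\<phi> i)"
    and dual: "\<And>i j. i \<in> I \<Longrightarrow> j \<in> I \<Longrightarrow> \<phi> i (w j) = 0 \<longleftrightarrow> i \<noteq> j"
  shows "card I \<le> local.dim V"
proof -
  have inj: "inj_on w I"
  proof (rule inj_onI, rule ccontr)
    fix i j assume "i \<in> I" "j \<in> I" "w i = w j" "i \<noteq> j"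
    then show False using dual[of i i] dual[of i j] by simp
  qed
  have "independent (w ` I)"
  proof (rule independent_if_scalars_zero)
    show "finite (w ` I)" using fin by simp
    fix f x assume sum0: "(\<Sum>x\<in>w ` I. scale (f x) x) = 0" and "x \<in> w ` I"
    then obtain i where i: "i \<in> I" "x = w i" by blast
    interpret \<phi>: Vector_Spaces.linear scale "(*)" "\<phi> i" by (rule lin[OF i(1)])
    have "0 = \<phi> i (\<Sum>j\<in>I. scale (f (w j)) (w j))"
      using sum0 inj by (simp add: sum.reindex)
    also have "\<dots> = (\<Sum>j\<in>I. f (w j) * \<phi> i (w j))"
      by (simp add: \<phi>.sum \<phi>.scale)
    also have "\<dots> = (\<Sum>j\<in>I. if j = i then f (w i) * \<phi> i (w i) else 0)"
      using dual[OF i(1)] by (intro sum.cong) auto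
    finally show "f x = 0" using fin i dual by simp
  qed
  then have "card (w ` I) \<le> local.dim V"
    using local.finitely_spanned_independent(2)[OF fs] w by blast
  then show ?thesis by (simp add: card_image inj)
qed

end

context vector_space_pair begin

text \<open>
  A basis \<open>B\<^sub>0\<close> of the kernel extends to a basis \<open>B\<close> of \<open>V\<close>, and \<open>f\<close> maps \<open>B - B\<^sub>0\<close> bijectively
  onto a basis of the image.
\<close>

lemma rank_nullity:
  assumes lin: "Vector_Spaces.linear s1 s2 f" and sub: "vs1.subspace V"
    and fs: "vs1.finitely_spanned V"
  shows "vs1.dim V = vs1.dim {v \<in> V. f v = 0} + vs2.dim (f ` V)"
    and "vs2.finitely_spanned (f ` V)"
proof -
  interpret f: Vector_Spaces.linear s1 s2 f by (rule lin)
  let ?K = "{v \<in> V. f v = 0}"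
  obtain B0 where B0: "B0 \<subseteq> ?K" "vs1.independent B0" "?K \<subseteq> vs1.span B0"
    using vs1.maximal_independent_subset[of ?K] by blast
  obtain B where B: "B0 \<subseteq> B" "B \<subseteq> V" "vs1.independent B" "V \<subseteq> vs1.span B"
    using vs1.maximal_independent_subset_extend[of B0 V] B0 by blast
  have finB: "finite B" using vs1.finitely_spanned_independent(1)[OF fs B(2,3)] .
  have K0: "f v = 0" if "v \<in> B0" for v using B0(1) that by auto
  have spanB: "vs1.span B = V"
    using vs1.span_minimal[OF B(2) sub] B(4) by blast
  have key: "\<forall>v\<in>B - B0. c v = 0" if c: "(\<Sum>v\<in>B - B0. s2 (c v) (f v)) = 0" for c
  proof -
    let ?y = "\<Sum>v\<in>B - B0. s1 (c v) v"
    have "f ?y = 0" using c by (simp add: f.sum f.scale)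
    moreover have "?y \<in> V" using B(2) sub
      by (intro vs1.subspace_sum vs1.subspace_scale) auto
    ultimately have "?y \<in> vs1.span B0" using B0(3) by blast
    then obtain e where e: "?y = (\<Sum>v\<in>B0. s1 (e v) v)"
      using vs1.span_finite[of B0] finB B(1) by (auto dest: finite_subset)
    let ?g = "\<lambda>v. if v \<in> B0 then - e v else c v"
    have "(\<Sum>v\<in>B. s1 (?g v) v) = (\<Sum>v\<in>B - B0. s1 (?g v) v) + (\<Sum>v\<in>B0. s1 (?g v) v)"
      by (rule sum.subset_diff[OF B(1) finB])
    also have "\<dots> = ?y + (\<Sum>v\<in>B0. s1 (- e v) v)"
      by (intro arg_cong2[where f = "(+)"] sum.cong) auto
    also have "\<dots> = 0" by (simp add: e sum_negf)
    finally have "\<And>v. v \<in> B \<Longrightarrow> ?g v = 0"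
      using vs1.independentD[OF B(3) finB subset_refl, where u = ?g] by blast
    then have "?g v = 0" if "v \<in> B - B0" for v using that by blast
    then show ?thesis by (auto split: if_splits)
  qed
  have inj: "inj_on f (B - B0)"
  proof (rule inj_onI, rule ccontr)
    fix x y assume xy: "x \<in> B - B0" "y \<in> B - B0" "f x = f y" "x \<noteq> y"
    let ?c = "\<lambda>v. if v = x then 1 else if v = y then - 1 else (0 :: 'a)"
    have "(\<Sum>v\<in>B - B0. s2 (?c v) (f v)) = (\<Sum>v\<in>{x, y}. s2 (?c v) (f v))"
      using xy finB by (intro sum.mono_neutral_right) auto
    also have "\<dots> = 0" using xy by simp
    finally have "\<forall>v\<in>B - B0. ?c v = 0" by (rule key)
    from bspec[OF this xy(1)] show False by simp
  qed
  have indep: "vs2.independent (f ` (B - B0))"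
  proof (rule vs2.independent_if_scalars_zero)
    show "finite (f ` (B - B0))" using finB by simp
    fix h x assume "(\<Sum>x\<in>f ` (B - B0). s2 (h x) x) = 0" "x \<in> f ` (B - B0)"
    then show "h x = 0" using key[of "\<lambda>v. h (f v)"] inj by (auto simp: sum.reindex)
  qed
  have span: "f ` V \<subseteq> vs2.span (f ` (B - B0))"
  proof -
    have "f ` V = vs2.span (f ` B)" using f.span_image spanB by simp
    also have "\<dots> \<subseteq> vs2.span (f ` (B - B0))"
    proof (rule vs2.span_minimal)
      show "f ` B \<subseteq> vs2.span (f ` (B - B0))"
      proof (rule image_subsetI)
        fix v assume "v \<in> B"
        then show "f v \<in> vs2.span (f ` (B - B0))"
          using K0[of v] vs2.span_zero vs2.span_base[of "f v"] by (cases "v \<in> B0") auto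
      qed
    qed simp
    finally show ?thesis .
  qed
  then show "vs2.finitely_spanned (f ` V)"
    using finB unfolding vs2.finitely_spanned_def by (intro exI[of _ "f ` (B - B0)"]) simp
  have "vs2.dim (f ` V) = card (B - B0)"
    using vs2.basis_card_eq_dim[OF image_mono span indep] B(2) inj by (simp add: card_image subset_iff)
  moreover have "vs1.dim ?K = card B0"
    using vs1.basis_card_eq_dim[OF B0(1,3,2)] by simp
  moreover have "vs1.dim V = card B"
    using vs1.basis_card_eq_dim[OF B(2,4,3)] by simp
  moreover have "card B = card B0 + card (B - B0)"
    using card_Diff_subset[OF finite_subset[OF B(1) finB] B(1)] card_mono[OF finB B(1)] by simp
  ultimately show "vs1.dim V = vs1.dim ?K + vs2.dim (f ` V)" by simp
qed

text \<open>
  This partial converse to the finiteness part of \<open>rank_nullity\<close> makes it possible to split off one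
  coordinate at a time from vectors of forms.
\<close>

lemma finitely_spanned_from_kernel_image:
  assumes lin: "Vector_Spaces.linear s1 s2 f" and sub: "vs1.subspace V"
    and ker: "vs1.finitely_spanned {v \<in> V. f v = 0}" and im: "vs2.finitely_spanned (f ` V)"
  shows "vs1.finitely_spanned V"
proof -
  interpret f: Vector_Spaces.linear s1 s2 f by (rule lin)
  obtain K where K: "finite K" "{v \<in> V. f v = 0} \<subseteq> vs1.span K"
    using ker unfolding vs1.finitely_spanned_def by (elim exE conjE)
  obtain B where B: "B \<subseteq> f ` V" "vs2.independent B" "f ` V \<subseteq> vs2.span B"
    by (rule vs2.maximal_independent_subset)
  have finB: "finite B" by (rule vs2.finitely_spanned_independent(1)[OF im B(1,2)])
  obtain C where C: "C \<subseteq> V" "finite C" "B = f ` C"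
    using finite_subset_image[OF finB B(1)] by auto
  have "V \<subseteq> vs1.span (K \<union> C)"
  proof
    fix v assume v: "v \<in> V"
    then have "f v \<in> f ` vs1.span C"
      using B(3) C(3) f.span_image by auto
    then obtain y where y: "y \<in> vs1.span C" "f v = f y" by auto
    have "y \<in> V" using vs1.span_minimal[OF C(1) sub] y(1) by auto
    then have "v - y \<in> vs1.span K"
      using K(2) v y(2) vs1.subspace_diff[OF sub] by (auto simp: f.diff)
    then have "v - y + y \<in> vs1.span (K \<union> C)"
      using y(1) vs1.span_mono[of K "K \<union> C"] vs1.span_mono[of C "K \<union> C"]
      by (intro vs1.span_add) auto
    then show "v \<in> vs1.span (K \<union> C)" by simp
  qed
  then show ?thesis
    using K(1) C(2) unfolding vs1.finitely_spanned_def by (intro exI[of _ "K \<union> C"]) simp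
qed

lemma dim_image_inj:
  assumes lin: "Vector_Spaces.linear s1 s2 f" and sub: "vs1.subspace V"
    and fs: "vs1.finitely_spanned V" and ker: "\<And>v. v \<in> V \<Longrightarrow> f v = 0 \<Longrightarrow> v = 0"
  shows "vs2.dim (f ` V) = vs1.dim V"
proof -
  interpret f: Vector_Spaces.linear s1 s2 f by (rule lin)
  have "{v \<in> V. f v = 0} = {0}" using ker vs1.subspace_0[OF sub] by auto
  moreover have "vs1.dim {0} = 0" using vs1.dim_le_card[of "{0}" "{}"] by simp
  ultimately show ?thesis using rank_nullity(1)[OF lin sub fs] by simp
qed

end

section \<open>The graded pieces of the polynomial ring\<close>

lemma const_0 [simp]: "const 0 = 0" and const_1 [simp]: "const 1 = 1"
  by (simp_all add: const_def pCons_one)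

lemma const_add: "const (a + b) = const a + const b"
  and const_mult: "const (a * b) = const a * const b"
  by (simp_all add: const_def)

lemma const_eq_0_iff [simp]: "const c = 0 \<longleftrightarrow> c = 0"
  by (simp add: const_def)

text \<open>
  The complex vector space structures on \<open>S\<close>, \<open>S\<^sup>3\<close> and \<open>S \<times> S\<close>. The interpretations \<open>CS\<close>, \<open>CV\<close>,
  \<open>CP\<close> stand for them, and \<open>CU\<close> for the one on polynomials in one variable.
\<close>

definition cscale :: "complex \<Rightarrow> S \<Rightarrow> S" where "cscale c p = const c * p"
definition cscale_vec :: "complex \<Rightarrow> S ^ 3 \<Rightarrow> S ^ 3" where "cscale_vec c v = const c *s v"
definition cscale_pair :: "complex \<Rightarrow> S \<times> S \<Rightarrow> S \<times> S" where
  "cscale_pair c = map_prod (cscale c) (cscale c)"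

interpretation CS: vector_space cscale
  by unfold_locales (simp_all add: cscale_def const_add const_mult algebra_simps)

interpretation CV: vector_space cscale_vec
  by unfold_locales (simp_all add: cscale_vec_def vec_eq_iff const_add const_mult algebra_simps)

interpretation CP: vector_space cscale_pair
  by unfold_locales
     (simp_all add: cscale_pair_def prod_eq_iff cscale_def const_add const_mult algebra_simps)

interpretation CU: vector_space "smult :: complex \<Rightarrow> complex poly \<Rightarrow> complex poly"
  by unfold_locales (simp_all add: smult_add_left smult_add_right)

definition mcoeff :: "S \<Rightarrow> nat \<Rightarrow> nat \<Rightarrow> nat \<Rightarrow> complex" where
  "mcoeff p i j k = coeff (coeff (coeff p k) j) i"

lemma S_eqI: "(\<And>i j k. mcoeff p i j k = mcoeff q i j k) \<Longrightarrow> p = q"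
  by (simp add: mcoeff_def poly_eq_iff)

lemma mcoeff_0 [simp]: "mcoeff 0 i j k = 0" and mcoeff_add: "mcoeff (p + q) i j k = mcoeff p i j k + mcoeff q i j k"
  by (simp_all add: mcoeff_def)

lemma mcoeff_const_mult: "mcoeff (const c * p) i j k = c * mcoeff p i j k"
  by (simp add: mcoeff_def const_def)

lemma mcoeff_sum: "mcoeff (\<Sum>x\<in>A. f x) i j k = (\<Sum>x\<in>A. mcoeff (f x) i j k)"
  by (simp add: mcoeff_def coeff_sum)

lemma mcoeff_mult:
  "mcoeff (p * q) i j k =
     (\<Sum>k'\<le>k. \<Sum>j'\<le>j. \<Sum>i'\<le>i. mcoeff p i' j' k' * mcoeff q (i - i') (j - j') (k - k'))"
  by (simp add: mcoeff_def coeff_mult coeff_sum)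

lemma homogeneous_iff_mcoeff: "homogeneous n p \<longleftrightarrow> (\<forall>i j k. mcoeff p i j k \<noteq> 0 \<longrightarrow> i + j + k = n)"
  by (simp add: homogeneous_def mcoeff_def)

lemma homogeneous_0 [simp]: "homogeneous n 0"
  and homogeneous_add: "homogeneous n p \<Longrightarrow> homogeneous n q \<Longrightarrow> homogeneous n (p + q)"
  by (auto simp: homogeneous_iff_mcoeff mcoeff_add) (metis add.right_neutral)

lemma homogeneous_const_mult: "homogeneous n p \<Longrightarrow> homogeneous n (const c * p)"
  by (simp add: homogeneous_iff_mcoeff mcoeff_const_mult)

lemma homogeneous_sum: "(\<And>x. x \<in> A \<Longrightarrow> homogeneous n (f x)) \<Longrightarrow> homogeneous n (\<Sum>x\<in>A. f x)"
  by (induction A rule: infinite_finite_induct) (auto intro: homogeneous_add)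

definition monomial :: "nat \<Rightarrow> nat \<Rightarrow> nat \<Rightarrow> S" where
  "monomial i j k = monom (monom (monom 1 i) j) k"

lemma mcoeff_monomial: "mcoeff (monomial i j k) i' j' k' = (if i' = i \<and> j' = j \<and> k' = k then 1 else 0)"
  by (auto simp: mcoeff_def monomial_def)

text \<open>
  The monomials \<open>x\<^sup>i y\<^sup>j z\<^bsup>n-i-j\<^esup>\<close> of degree \<open>n\<close>, given by the pairs \<open>(i, j)\<close>.
\<close>

definition exponents :: "nat \<Rightarrow> (nat \<times> nat) set" where "exponents n = (SIGMA i:{..n}. {..n - i})"

lemma finite_exponents [simp]: "finite (exponents n)"
  by (simp add: exponents_def)

lemma mem_exponents: "(i, j) \<in> exponents n \<longleftrightarrow> i + j \<le> n"
  by (auto simp: exponents_def)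

lemma card_exponents: "2 * card (exponents n) = (n + 1) * (n + 2)"
proof -
  have "card (exponents n) = (\<Sum>i\<le>n. n - i + 1)"
    by (simp add: exponents_def)
  also have "\<dots> = (\<Sum>i\<le>n. i + 1)"
    by (rule sum.reindex_bij_witness[of _ "\<lambda>i. n - i" "\<lambda>i. n - i"]) auto
  finally have "card (exponents n) = (\<Sum>i\<le>n. i + 1)" .
  moreover have "2 * (\<Sum>i\<le>n. i + 1) = (n + 1) * (n + 2)"
    by (induction n) auto
  ultimately show ?thesis by simp
qed

definition hom_part :: "nat \<Rightarrow> S \<Rightarrow> S" where
  "hom_part n p = (\<Sum>(i, j)\<in>exponents n. const (mcoeff p i j (n - i - j)) * monomial i j (n - i - j))"

lemma mcoeff_hom_part: "mcoeff (hom_part n p) i j k = (if i + j + k = n then mcoeff p i j k else 0)"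
proof -
  have "mcoeff (hom_part n p) i j k =
      (\<Sum>x\<in>exponents n. if x = (i, j) then (if i + j + k = n then mcoeff p i j k else 0) else 0)"
    unfolding hom_part_def mcoeff_sum
    by (intro sum.cong) (auto simp: mcoeff_const_mult mcoeff_monomial mem_exponents split: if_splits)
  then show ?thesis by (auto simp: mem_exponents)
qed

lemma homogeneous_hom_part [simp]: "homogeneous n (hom_part n p)"
  by (simp add: homogeneous_iff_mcoeff mcoeff_hom_part)

lemma hom_part_eq: "homogeneous n p \<Longrightarrow> hom_part n p = p"
  by (rule S_eqI) (auto simp: homogeneous_iff_mcoeff mcoeff_hom_part)

lemma hom_part_add: "hom_part n (p + q) = hom_part n p + hom_part n q"
  by (rule S_eqI) (simp add: mcoeff_hom_part mcoeff_add)

text \<open>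
  Multiplication by a form of degree \<open>m\<close> shifts the grading by \<open>m\<close>. This also gives the
  homogeneity of products, and it lets homogeneous relations have homogeneous coefficients.
\<close>

lemma hom_part_mult:
  assumes "homogeneous m q"
  shows "hom_part (n + m) (p * q) = hom_part n p * q"
proof (rule S_eqI)
  fix i j k
  have q: "mcoeff q i j k = 0" if "i + j + k \<noteq> m" for i j k
    using assms that by (auto simp: homogeneous_iff_mcoeff)
  have "mcoeff (hom_part n p) i' j' k' * mcoeff q (i - i') (j - j') (k - k') =
      (if i + j + k = n + m then mcoeff p i' j' k' * mcoeff q (i - i') (j - j') (k - k') else 0)"
    if "i' \<le> i" "j' \<le> j" "k' \<le> k" for i' j' k'
    using that q[of "i - i'" "j - j'" "k - k'"] by (auto simp: mcoeff_hom_part)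
  then show "mcoeff (hom_part (n + m) (p * q)) i j k = mcoeff (hom_part n p * q) i j k"
    unfolding mcoeff_hom_part mcoeff_mult by (auto intro!: sum.cong simp: sum.neutral)
qed

lemma homogeneous_mult:
  assumes "homogeneous n p" "homogeneous m q"
  shows "homogeneous (n + m) (p * q)"
  using homogeneous_hom_part[of "n + m" "p * q"] hom_part_mult[OF assms(2), of n p]
    hom_part_eq[OF assms(1)] by simp

lemma homogeneous_1: "homogeneous 0 1"
  by (auto simp: homogeneous_iff_mcoeff mcoeff_def coeff_1 split: if_splits)

lemma homogeneous_prod:
  "finite A \<Longrightarrow> (\<And>x. x \<in> A \<Longrightarrow> homogeneous 1 (f x)) \<Longrightarrow> homogeneous (card A) (\<Prod>x\<in>A. f x)"
proof (induction A rule: finite_induct)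
  case (insert x A)
  then show ?case using homogeneous_mult[of 1 "f x" "card A"] by simp
qed (simp add: homogeneous_1)

lemma homogeneous_power: "homogeneous m p \<Longrightarrow> homogeneous (m * n) (p ^ n)"
  by (induction n) (auto simp: homogeneous_1 dest: homogeneous_mult[of m p])

definition forms :: "nat \<Rightarrow> S set" where "forms n = {p. homogeneous n p}"

lemma subspace_forms: "CS.subspace (forms n)"
  by (auto simp: CS.subspace_def forms_def cscale_def homogeneous_add homogeneous_const_mult)

text \<open>
  The monomials of degree \<open>n\<close> span the forms, and their coefficient functionals are a dual family.
\<close>

lemma
  shows finitely_spanned_forms: "CS.finitely_spanned (forms n)"
    and dim_forms: "CS.dim (forms n) = card (exponents n)"
proof -
  let ?m = "\<lambda>(i, j). monomial i j (n - i - j)"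
  have sub: "forms n \<subseteq> CS.span (?m ` exponents n)"
  proof
    fix p assume "p \<in> forms n"
    then have "p = (\<Sum>(i, j)\<in>exponents n. const (mcoeff p i j (n - i - j)) * monomial i j (n - i - j))"
      by (metis forms_def hom_part_def hom_part_eq mem_Collect_eq)
    also have "\<dots> \<in> CS.span (?m ` exponents n)"
      proof (intro CS.span_sum, clarify, fold cscale_def)
      fix i j assume "(i, j) \<in> exponents n"
      then show "cscale (mcoeff p i j (n - i - j)) (monomial i j (n - i - j)) \<in> CS.span (?m ` exponents n)"
        by (intro CS.span_scale CS.span_base) force
    qed
    finally show "p \<in> CS.span (?m ` exponents n)" .
  qed
  then show fs: "CS.finitely_spanned (forms n)"
    unfolding CS.finitely_spanned_def by (intro exI[of _ "?m ` exponents n"]) simp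
  have "card (exponents n) \<le> CS.dim (forms n)"
  proof (rule CS.dual_family_card_le_dim[OF fs finite_exponents, where w = ?m and
        \<phi> = "\<lambda>x p. case x of (i, j) \<Rightarrow> mcoeff p i j (n - i - j)"])
    show "?m x \<in> forms n" if "x \<in> exponents n" for x
      using that by (cases x) (auto simp: forms_def homogeneous_iff_mcoeff mcoeff_monomial mem_exponents split: if_splits)
    show "Vector_Spaces.linear cscale (*) (\<lambda>p. case x of (i, j) \<Rightarrow> mcoeff p i j (n - i - j))" for x
      by unfold_locales (auto simp: cscale_def mcoeff_add mcoeff_const_mult split: prod.splits)
  qed (auto simp: mcoeff_monomial split: if_splits)
  moreover have "CS.dim (forms n) \<le> card (exponents n)"
    using CS.dim_le_card[OF sub] card_image_le[OF finite_exponents, of ?m n] by simp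
  ultimately show "CS.dim (forms n) = card (exponents n)" by simp
qed

section \<open>Graded pieces of free modules\<close>

lemma forms_0 [simp]: "0 \<in> forms n" by (simp add: forms_def)

lemma dim_trivial [simp]: "CV.dim {0} = 0" "CP.dim {0} = 0"
  using CV.dim_le_card[of "{0}" "{}"] CP.dim_le_card[of "{0}" "{}"]
  by simp_all

lemma finitely_spanned_trivial [simp]:
  "CV.finitely_spanned {0}" "CP.finitely_spanned {0}"
  unfolding CV.finitely_spanned_def CP.finitely_spanned_def
  by (auto intro: exI[of _ "{}"])

lemma vector_space_pairs:
  "vector_space_pair cscale_vec cscale" "vector_space_pair cscale_vec smult"
  "vector_space_pair cscale_pair cscale" "vector_space_pair cscale_pair cscale_vec"
  "vector_space_pair cscale cscale"
  by (intro vector_space_pair.intro CS.vector_space_axioms CV.vector_space_axioms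
        CP.vector_space_axioms CU.vector_space_axioms)+

interpretation VS: vector_space_pair cscale_vec cscale by (rule vector_space_pairs)
interpretation VU: vector_space_pair cscale_vec "smult :: complex \<Rightarrow> _" by (rule vector_space_pairs)
interpretation PS: vector_space_pair cscale_pair cscale by (rule vector_space_pairs)
interpretation PV: vector_space_pair cscale_pair cscale_vec by (rule vector_space_pairs)
interpretation SS: vector_space_pair cscale cscale by (rule vector_space_pairs)

definition form_vecs :: "nat \<Rightarrow> (S ^ 3) set" where "form_vecs n = {v. homogeneous_vec n v}"

lemma subspace_form_vecs: "CV.subspace (form_vecs n)"
  by (auto simp: CV.subspace_def form_vecs_def homogeneous_vec_def cscale_vec_def
      homogeneous_add homogeneous_const_mult)

lemma linear_component: "Vector_Spaces.linear cscale_vec cscale (\<lambda>v. v $ i)"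
  by unfold_locales (simp_all add: cscale_vec_def cscale_def)

text \<open>
  The three components are split off successively: each is a linear map onto the forms of degree
  \<open>n\<close>, and the kernel of one is the domain of the next.
\<close>

lemma
  shows finitely_spanned_form_vecs: "CV.finitely_spanned (form_vecs n)"
    and dim_form_vecs: "CV.dim (form_vecs n) = 3 * card (exponents n)"
proof -
  define K1 where "K1 = {v \<in> form_vecs n. v $ 1 = 0}"
  define K2 where "K2 = {v \<in> K1. v $ 2 = 0}"
  have sub1: "CV.subspace K1" and sub2: "CV.subspace K2"
    using subspace_form_vecs[of n] by (auto simp: K1_def K2_def CV.subspace_def cscale_vec_def)
  have im: "(\<lambda>v. v $ 1) ` form_vecs n = forms n"
    "(\<lambda>v. v $ 2) ` K1 = forms n" "(\<lambda>v. v $ 3) ` K2 = forms n"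
  proof -
    have "p \<in> (\<lambda>v. v $ 1) ` form_vecs n" "p \<in> (\<lambda>v. v $ 2) ` K1" "p \<in> (\<lambda>v. v $ 3) ` K2"
      if "p \<in> forms n" for p
      using that by (intro image_eqI[of _ _ "vector [p, 0, 0]"] image_eqI[of _ _ "vector [0, p, 0]"]
          image_eqI[of _ _ "vector [0, 0, p]"];
        simp add: form_vecs_def forms_def homogeneous_vec_def forall_3 K1_def K2_def)+
    then show "(\<lambda>v. v $ 1) ` form_vecs n = forms n"
      "(\<lambda>v. v $ 2) ` K1 = forms n" "(\<lambda>v. v $ 3) ` K2 = forms n"
      by (auto simp: form_vecs_def forms_def homogeneous_vec_def K1_def K2_def intro!: equalityI subsetI)
  qed
  have ker: "{v \<in> K2. v $ 3 = 0} = {0}"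
    by (auto simp: K1_def K2_def form_vecs_def homogeneous_vec_def vec_eq_iff forall_3)
  have fs2: "CV.finitely_spanned K2"
    by (rule VS.finitely_spanned_from_kernel_image[OF linear_component[of 3] sub2])
       (simp_all add: ker im finitely_spanned_forms)
  have fs1: "CV.finitely_spanned K1"
    by (rule VS.finitely_spanned_from_kernel_image[OF linear_component[of 2] sub1])
       (simp_all add: im finitely_spanned_forms fs2 flip: K2_def)
  show fs: "CV.finitely_spanned (form_vecs n)"
    by (rule VS.finitely_spanned_from_kernel_image[OF linear_component[of 1] subspace_form_vecs])
       (simp_all add: im finitely_spanned_forms fs1 flip: K1_def)
  show "CV.dim (form_vecs n) = 3 * card (exponents n)"
    using VS.rank_nullity(1)[OF linear_component[of 1] subspace_form_vecs fs]
      VS.rank_nullity(1)[OF linear_component[of 2] sub1 fs1]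
      VS.rank_nullity(1)[OF linear_component[of 3] sub2 fs2]
    by (simp add: im ker dim_forms flip: K1_def K2_def)
qed

lemma
  shows subspace_form_pairs: "CP.subspace (forms m \<times> forms n)"
    and finitely_spanned_form_pairs: "CP.finitely_spanned (forms m \<times> forms n)"
    and dim_form_pairs: "CP.dim (forms m \<times> forms n) = card (exponents m) + card (exponents n)"
proof -
  define V where "V = forms m \<times> forms n"
  define K where "K = {v \<in> V. fst v = 0}"
  have lin: "Vector_Spaces.linear cscale_pair cscale fst" "Vector_Spaces.linear cscale_pair cscale snd"
    by (unfold_locales, simp_all add: cscale_pair_def)
  show sub: "CP.subspace (forms m \<times> forms n)"
    using subspace_forms[of m] subspace_forms[of n]
    by (auto simp: CS.subspace_def CP.subspace_def cscale_pair_def zero_prod_def)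
  then have subK: "CP.subspace K"
    by (auto simp: CP.subspace_def K_def V_def cscale_pair_def cscale_def)
  have im: "fst ` V = forms m" "snd ` K = forms n"
    using forms_0[of m] forms_0[of n] by (auto simp: V_def K_def image_iff simp del: forms_0)
  have ker: "{v \<in> K. snd v = 0} = {0}"
    by (auto simp: zero_prod_def K_def V_def)
  have fsK: "CP.finitely_spanned K"
    by (rule PS.finitely_spanned_from_kernel_image[OF lin(2) subK])
       (simp_all add: im ker finitely_spanned_forms)
  have fs: "CP.finitely_spanned V"
    by (rule PS.finitely_spanned_from_kernel_image[OF lin(1) sub[folded V_def]])
       (simp_all add: im fsK finitely_spanned_forms flip: K_def)
  then show "CP.finitely_spanned (forms m \<times> forms n)" by (simp add: V_def)
  have "CP.dim V = card (exponents m) + card (exponents n)"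
    using PS.rank_nullity(1)[OF lin(1) sub[folded V_def] fs] PS.rank_nullity(1)[OF lin(2) subK fsK]
    by (simp add: im ker dim_forms flip: K_def)
  then show "CP.dim (forms m \<times> forms n) = card (exponents m) + card (exponents n)"
    by (simp add: V_def)
qed

text \<open>
  In degree \<open>a + b + N\<close> the map \<open>(p, q) \<mapsto> p \<theta> + q \<eta>\<close> is a bijection from the pairs of forms of
  degrees \<open>b + N\<close> and \<open>a + N\<close>. It is injective because \<open>\<theta>, \<eta>\<close> are independent over \<open>S\<close>, and
  surjective because the coefficients of a homogeneous element can be replaced by their
  homogeneous parts. The degree is written as \<open>a + b + N\<close> so that no subtraction truncates.
\<close>

lemma dim_graded_piece_free_rank_2:
  assumes indep: "S3.independent {\<theta>, \<eta>}" and ne: "\<theta> \<noteq> \<eta>"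
    and hom: "homogeneous_vec a \<theta>" "homogeneous_vec b \<eta>"
  shows "CV.dim (S3.span {\<theta>, \<eta>} \<inter> form_vecs (a + b + N)) =
           card (exponents (b + N)) + card (exponents (a + N))"
proof -
  define F where "F = (\<lambda>(p, q). p *s \<theta> + q *s \<eta>)"
  define V where "V = forms (b + N) \<times> forms (a + N)"
  have lin: "Vector_Spaces.linear cscale_pair cscale_vec F"
    by unfold_locales
      (auto simp: F_def cscale_pair_def cscale_def cscale_vec_def vec_eq_iff algebra_simps)
  have ker: "v = 0" if "F v = 0" for v
  proof -
    obtain p q where v: "v = (p, q)" by (cases v)
    let ?u = "\<lambda>x. if x = \<theta> then p else q"
    have "(\<Sum>x\<in>{\<theta>, \<eta>}. ?u x *s x) = 0"
      using that ne by (simp add: F_def v)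
    then have "?u x = 0" if "x \<in> {\<theta>, \<eta>}" for x
      using S3.independentD[OF indep, of "{\<theta>, \<eta>}" ?u x] that by blast
    from this[of \<theta>] this[of \<eta>] show ?thesis using ne by (auto simp: v zero_prod_def)
  qed
  have "F ` V = S3.span {\<theta>, \<eta>} \<inter> form_vecs (a + b + N)"
  proof (intro equalityI subsetI)
    fix x assume "x \<in> F ` V"
    then obtain p q where x: "x = p *s \<theta> + q *s \<eta>" "p \<in> forms (b + N)" "q \<in> forms (a + N)"
      by (auto simp: F_def V_def)
    have "homogeneous (a + b + N) (p * \<theta> $ i + q * \<eta> $ i)" for i
      using homogeneous_mult[of "b + N" p a "\<theta> $ i"] homogeneous_mult[of "a + N" q b "\<eta> $ i"] x hom
      by (intro homogeneous_add) (auto simp: forms_def homogeneous_vec_def ac_simps)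
    then have "x \<in> form_vecs (a + b + N)"
      by (simp add: x(1) form_vecs_def homogeneous_vec_def)
    moreover have "x \<in> S3.span {\<theta>, \<eta>}"
      unfolding x(1) by (intro S3.span_add S3.span_scale S3.span_base) auto
    ultimately show "x \<in> S3.span {\<theta>, \<eta>} \<inter> form_vecs (a + b + N)" by blast
  next
    fix x assume x: "x \<in> S3.span {\<theta>, \<eta>} \<inter> form_vecs (a + b + N)"
    then obtain p q where pq: "x = p *s \<theta> + q *s \<eta>"
      by (auto simp: S3.span_insert algebra_simps)
    have "x = F (hom_part (b + N) p, hom_part (a + N) q)"
    proof (subst vec_eq_iff, intro allI)
      fix i
      have "x $ i = hom_part (a + b + N) (p * \<theta> $ i + q * \<eta> $ i)"
        using x pq by (simp add: form_vecs_def homogeneous_vec_def hom_part_eq)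
      also have "\<dots> = hom_part (b + N) p * \<theta> $ i + hom_part (a + N) q * \<eta> $ i"
        using hom_part_mult[of a "\<theta> $ i" "b + N" p] hom_part_mult[of b "\<eta> $ i" "a + N" q] hom
        by (simp add: hom_part_add homogeneous_vec_def ac_simps)
      finally show "x $ i = F (hom_part (b + N) p, hom_part (a + N) q) $ i"
        by (simp add: F_def)
    qed
    then show "x \<in> F ` V" by (auto simp: V_def forms_def)
  qed
  then show ?thesis
    using PV.dim_image_inj[OF lin subspace_form_pairs finitely_spanned_form_pairs, of "b + N" "a + N"] ker
    by (simp add: V_def dim_form_pairs)
qed

section \<open>Restriction to a line\<close>

definition dot3 :: "complex ^ 3 \<Rightarrow> complex ^ 3 \<Rightarrow> complex" where
  "dot3 a x = a $ 1 * x $ 1 + a $ 2 * x $ 2 + a $ 3 * x $ 3"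

lemma dot3_add_right: "dot3 a (x + y) = dot3 a x + dot3 a y"
  and dot3_diff_right: "dot3 a (x - y) = dot3 a x - dot3 a y"
  and dot3_scale_right: "dot3 a (c *s x) = c * dot3 a x"
  by (simp_all add: dot3_def algebra_simps)

definition ring_hom :: "('a::comm_ring_1 \<Rightarrow> 'b::comm_ring_1) \<Rightarrow> bool" where
  "ring_hom h \<longleftrightarrow> h 0 = 0 \<and> h 1 = 1 \<and> (\<forall>x y. h (x + y) = h x + h y) \<and> (\<forall>x y. h (x * y) = h x * h y)"

lemma ring_hom_eval:
  assumes h: "ring_hom h"
  shows "ring_hom (\<lambda>p. poly (map_poly h p) r)"
proof -
  let ?e = "\<lambda>p. poly (map_poly h p) r"
  note [simp] = h[unfolded ring_hom_def]
  have pc: "?e (pCons a p) = h a + r * ?e p" for a p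
    by (simp add: map_poly_pCons)
  have add: "?e (p + q) = ?e p + ?e q" for p q
    by (induction p q rule: poly_induct2) (simp_all add: pc algebra_simps)
  have sm: "?e (smult a p) = h a * ?e p" for a p
    by (induction p) (simp_all add: pc algebra_simps)
  have "?e (p * q) = ?e p * ?e q" for p q
    by (induction p) (simp_all add: pc add sm algebra_simps)
  then show ?thesis by (simp add: ring_hom_def add)
qed

text \<open>
  The restriction of a polynomial to the affine line \<open>s \<mapsto> s p + q\<close>, as a polynomial in \<open>s\<close>. If \<open>p\<close>
  and \<open>q\<close> are a basis of the plane over a projective line, then this is the restriction of forms
  to that line, dehomogenised with \<open>p\<close> as the point at infinity. Evaluation is done one variable at
  a time, so that it is visibly a composition of ring homomorphisms.
\<close>

definition restrict_line :: "complex ^ 3 \<Rightarrow> complex ^ 3 \<Rightarrow> S \<Rightarrow> complex poly" where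
  "restrict_line p q F =
     poly (map_poly (\<lambda>G. poly (map_poly (\<lambda>h. poly (map_poly (\<lambda>c. [:c:]) h) [:q $ 1, p $ 1:])
       G) [:q $ 2, p $ 2:]) F) [:q $ 3, p $ 3:]"

lemma ring_hom_restrict_line: "ring_hom (restrict_line p q)"
  unfolding restrict_line_def [abs_def]
  by (intro ring_hom_eval) (simp add: ring_hom_def pCons_one)

lemma restrict_line_0 [simp]: "restrict_line p q 0 = 0"
  and restrict_line_1 [simp]: "restrict_line p q 1 = 1"
  and restrict_line_add: "restrict_line p q (F + G) = restrict_line p q F + restrict_line p q G"
  and restrict_line_mult: "restrict_line p q (F * G) = restrict_line p q F * restrict_line p q G"
  using ring_hom_restrict_line[of p q] by (simp_all add: ring_hom_def)

lemma restrict_line_sum: "restrict_line p q (\<Sum>x\<in>A. F x) = (\<Sum>x\<in>A. restrict_line p q (F x))"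
  by (induction A rule: infinite_finite_induct) (simp_all add: restrict_line_add)

lemma restrict_line_prod: "restrict_line p q (\<Prod>x\<in>A. F x) = (\<Prod>x\<in>A. restrict_line p q (F x))"
  by (induction A rule: infinite_finite_induct) (simp_all add: restrict_line_mult)

lemma restrict_line_power: "restrict_line p q (F ^ n) = restrict_line p q F ^ n"
  by (induction n) (simp_all add: restrict_line_mult)

lemma restrict_line_const [simp]: "restrict_line p q (const c) = [:c:]"
  by (simp add: restrict_line_def const_def map_poly_pCons)

lemma restrict_line_cscale: "restrict_line p q (cscale c F) = smult c (restrict_line p q F)"
  by (simp add: cscale_def restrict_line_mult)

lemma restrict_line_var:
  "restrict_line p q var_x = [:q $ 1, p $ 1:]" "restrict_line p q var_y = [:q $ 2, p $ 2:]"
  "restrict_line p q var_z = [:q $ 3, p $ 3:]"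
  by (simp_all add: restrict_line_def var_x_def var_y_def var_z_def map_poly_pCons)

text \<open>
  For a line that does not pass through \<open>p\<close> the restriction has degree exactly one. This is why the
  points at infinity will be chosen off all the other lines.
\<close>

lemma restrict_line_linear_form: "restrict_line p q (linear_form a) = [:dot3 a q, dot3 a p:]"
  by (simp add: linear_form_def restrict_line_add restrict_line_mult restrict_line_var dot3_def)

lemma homogeneous_variables:
  "homogeneous 1 var_x" "homogeneous 1 var_y" "homogeneous 1 var_z"
  by (auto simp: homogeneous_def var_x_def var_y_def var_z_def coeff_pCons split: nat.splits)

lemma homogeneous_linear_form: "homogeneous 1 (linear_form a)"
  unfolding linear_form_def
  by (intro homogeneous_add homogeneous_const_mult homogeneous_variables)

section \<open>Derivations and the Euler field\<close>

definition derivation :: "('a::comm_ring_1 \<Rightarrow> 'a) \<Rightarrow> bool" where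
  "derivation D \<longleftrightarrow> (\<forall>x y. D (x + y) = D x + D y) \<and> (\<forall>x y. D (x * y) = D x * y + x * D y)"

lemma derivation_0: "derivation D \<Longrightarrow> D 0 = 0"
  unfolding derivation_def by (metis add_cancel_right_right)

lemma derivation_1: "derivation D \<Longrightarrow> D 1 = 0"
  unfolding derivation_def by (metis add_cancel_right_right mult.right_neutral mult_1)

lemma derivation_sum: "derivation D \<Longrightarrow> D (\<Sum>x\<in>A. f x) = (\<Sum>x\<in>A. D (f x))"
  by (induction A rule: infinite_finite_induct) (simp_all add: derivation_0, simp add: derivation_def)

text \<open>
  A derivation of the coefficient ring, applied to the coefficients, is a derivation. In the nested
  representation of \<open>S\<close> the derivatives in the inner variables are of this form.
\<close>

lemma derivation_map_poly:
  assumes D: "derivation D"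
  shows "derivation (map_poly D)"
proof -
  note D0 = derivation_0[OF D] and Ds = derivation_sum[OF D]
  have D_add: "D (x + y) = D x + D y" and D_mult: "D (x * y) = D x * y + x * D y" for x y
    using D by (simp_all add: derivation_def)
  have "map_poly D (p + q) = map_poly D p + map_poly D q" for p q
    by (simp add: poly_eq_iff coeff_map_poly D0 D_add)
  moreover have "map_poly D (p * q) = map_poly D p * q + p * map_poly D q" for p q
    by (simp add: poly_eq_iff coeff_map_poly D0 coeff_mult Ds D_mult sum.distrib)
  ultimately show ?thesis by (simp add: derivation_def)
qed

lemma derivation_partial: "derivation partial_x" "derivation partial_y" "derivation partial_z"
proof -
  have "derivation (pderiv :: complex poly \<Rightarrow> _)" "derivation (pderiv :: complex poly poly \<Rightarrow> _)"
    "derivation (pderiv :: S \<Rightarrow> _)"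
    by (simp_all add: derivation_def pderiv_add pderiv_mult algebra_simps)
  then show "derivation partial_x" "derivation partial_y" "derivation partial_z"
    unfolding partial_x_def [abs_def] partial_y_def [abs_def] partial_z_def [abs_def]
    by (auto intro: derivation_map_poly)
qed

definition apply_field :: "S ^ 3 \<Rightarrow> S \<Rightarrow> S" where
  "apply_field v f = v $ 1 * partial_x f + v $ 2 * partial_y f + v $ 3 * partial_z f"

lemma AR_eq: "AR f = {v. apply_field v f = 0}"
  by (simp add: AR_def apply_field_def)

lemma derivation_apply_field: "derivation (apply_field v)"
  using derivation_partial unfolding derivation_def apply_field_def by (simp add: algebra_simps)

lemma derivation_prod:
  assumes D: "derivation D" and "finite A"
  shows "D (\<Prod>x\<in>A. f x) = (\<Sum>x\<in>A. D (f x) * (\<Prod>y\<in>A - {x}. f y))"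
  using assms(2)
proof (induction A rule: finite_induct)
  case (insert x A)
  have "D (\<Prod>y\<in>insert x A. f y) = D (f x) * prod f A + f x * D (prod f A)"
    using D insert.hyps by (simp add: derivation_def)
  also have "f x * D (prod f A) = (\<Sum>y\<in>A. D (f y) * (\<Prod>z\<in>insert x A - {y}. f z))"
    unfolding insert.IH sum_distrib_left
  proof (rule sum.cong)
    fix y assume "y \<in> A"
    then have "insert x A - {y} = insert x (A - {y})" using insert.hyps by auto
    then show "f x * (D (f y) * prod f (A - {y})) = D (f y) * (\<Prod>z\<in>insert x A - {y}. f z)"
      using insert.hyps by (simp add: ac_simps)
  qed simp
  finally show ?case using insert.hyps by (simp add: insert_Diff_if)
qed (simp add: derivation_1[OF D])

lemma partial_linear_form:
  "partial_x (linear_form a) = const (a $ 1)" "partial_y (linear_form a) = const (a $ 2)"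
  "partial_z (linear_form a) = const (a $ 3)"
  by (simp_all add: linear_form_def const_def var_x_def var_y_def var_z_def partial_x_def
      partial_y_def partial_z_def map_poly_pCons pderiv_pCons)

lemma apply_field_linear_form:
  "apply_field v (linear_form a) = v $ 1 * const (a $ 1) + v $ 2 * const (a $ 2) + v $ 3 * const (a $ 3)"
  by (simp add: apply_field_def partial_linear_form)

lemma linear_apply_field: "Vector_Spaces.linear cscale_vec cscale (\<lambda>v. apply_field v f)"
  by unfold_locales (simp_all add: apply_field_def cscale_vec_def cscale_def algebra_simps)

text \<open>
  The Euler field \<open>x \<partial>\<^sub>x + y \<partial>\<^sub>y + z \<partial>\<^sub>z\<close>.
\<close>

definition euler :: "S ^ 3" where "euler = vector [var_x, var_y, var_z]"

lemma apply_field_scale: "apply_field (g *s v) f = g * apply_field v f"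
  by (simp add: apply_field_def algebra_simps)

lemma euler_linear_form: "apply_field euler (linear_form a) = linear_form a"
  by (simp add: apply_field_linear_form euler_def) (simp add: linear_form_def)

lemma homogeneous_euler: "homogeneous_vec 1 euler"
  using homogeneous_variables by (simp add: homogeneous_vec_def euler_def forall_3)

lemma euler_prod_linear_forms:
  assumes "finite A"
  shows "apply_field euler (\<Prod>x\<in>A. linear_form (a x)) = of_nat (card A) * (\<Prod>x\<in>A. linear_form (a x))"
proof -
  have "linear_form (a x) * (\<Prod>y\<in>A - {x}. linear_form (a y)) = (\<Prod>y\<in>A. linear_form (a y))"
    if "x \<in> A" for x
    using prod.remove[OF assms that, of "\<lambda>y. linear_form (a y)"] by simp
  then show ?thesis
    by (simp add: derivation_prod[OF derivation_apply_field assms] euler_linear_form)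
qed

lemma apply_field_prod_homogeneous:
  assumes v: "v \<in> form_vecs n" and A: "finite A" "A \<noteq> {}"
  shows "apply_field v (\<Prod>x\<in>A. linear_form (a x)) \<in> forms (n + card A - 1)"
proof -
  have "homogeneous (n + card A - 1)
          (apply_field v (linear_form (a x)) * (\<Prod>y\<in>A - {x}. linear_form (a y)))" if x: "x \<in> A" for x
  proof -
    have "card A > 0" using A by (simp add: card_gt_0_iff)
    then have eq: "n + card A - 1 = n + card (A - {x})"
      using x A(1) by (simp add: card_Diff_singleton)
    have "homogeneous n (apply_field v (linear_form (a x)))"
      using v unfolding apply_field_linear_form mult.commute[of "v $ _"]
      by (intro homogeneous_add homogeneous_const_mult) (auto simp: form_vecs_def homogeneous_vec_def)
    then show ?thesis
      unfolding eq using A(1) by (intro homogeneous_mult homogeneous_prod homogeneous_linear_form) auto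
  qed
  then show ?thesis
    using A(1) by (simp add: derivation_prod[OF derivation_apply_field] forms_def homogeneous_sum)
qed

section \<open>Vector fields tangent to an arrangement\<close>

text \<open>
  The first summand of the bound is the number of distinct roots. Let \<open>R\<close> select one factor for each
  root, let \<open>f\<close> be the product of all factors and \<open>b\<close> that of the factors outside \<open>R\<close>. The
  polynomials \<open>f s\<^sup>i\<close> and, for \<open>r\<close> in \<open>R\<close>, the products of all factors except \<open>r\<close> are independent.
  For dividing by \<open>b\<close> and evaluating at the root of \<open>r\<close> isolates one of the latter, and dividing by
  \<open>f\<close>, whose degree exceeds that of the latter, isolates the former.
\<close>

lemma dim_ge_products_of_linear_factors:
  fixes \<beta> \<gamma> :: "'i \<Rightarrow> complex" and W :: "complex poly set"
  defines "fac \<equiv> \<lambda>m. [:\<beta> m, \<gamma> m:]"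
  assumes fin: "finite A" and nz: "\<And>m. m \<in> A \<Longrightarrow> \<gamma> m \<noteq> 0"
    and fs: "CU.finitely_spanned W"
    and mult: "\<And>i. i \<le> M \<Longrightarrow> (\<Prod>m\<in>A. fac m) * monom 1 i \<in> W"
    and omit: "\<And>m. m \<in> A \<Longrightarrow> (\<Prod>m'\<in>A - {m}. fac m') \<in> W"
  shows "card ((\<lambda>m. - \<beta> m / \<gamma> m) ` A) + M + 1 \<le> CU.dim W"
proof -
  define \<rho> where "\<rho> m = - \<beta> m / \<gamma> m" for m
  obtain R where R: "R \<subseteq> A" "inj_on \<rho> R" "\<rho> ` A = \<rho> ` R"
    using subset_image_inj[of "\<rho> ` A" \<rho> A] by auto
  have finR: "finite R" using R(1) fin finite_subset by blast
  define b where "b = (\<Prod>m\<in>A - R. fac m)"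
  define f where "f = (\<Prod>m\<in>A. fac m)"
  have nz_fac: "fac m \<noteq> 0" if "m \<in> A" for m using nz[OF that] by (simp add: fac_def)
  have b0: "b \<noteq> 0" and f0: "f \<noteq> 0"
    using fin nz_fac by (auto simp: b_def f_def)
  have fb: "f = b * (\<Prod>m\<in>R. fac m)"
    using prod.subset_diff[OF R(1) fin, of fac] by (simp add: f_def b_def)
  have root: "poly (fac m) (\<rho> r) = 0 \<longleftrightarrow> m = r" if "m \<in> R" "r \<in> R" for m r
  proof -
    have "poly (fac m) (\<rho> r) = 0 \<longleftrightarrow> \<rho> m = \<rho> r"
      using nz[of m] that R(1) by (auto simp: fac_def \<rho>_def field_simps add_eq_0_iff)
    then show ?thesis using R(2) that by (auto dest: inj_onD)
  qed
  define w where "w = case_sum (\<lambda>r. b * (\<Prod>m\<in>R - {r}. fac m)) (\<lambda>i. f * monom 1 i)"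
  define \<phi> where "\<phi> = case_sum (\<lambda>r g. poly (g div b) (\<rho> r)) (\<lambda>i g. coeff (g div f) i)"
  have wr: "w (Inl r) = (\<Prod>m\<in>A - {r}. fac m)" if "r \<in> R" for r
  proof -
    have "(\<Prod>m\<in>A - {r}. fac m) = (\<Prod>m\<in>(A - {r}) - (R - {r}). fac m) * (\<Prod>m\<in>R - {r}. fac m)"
      using R(1) fin by (intro prod.subset_diff) auto
    moreover have "(A - {r}) - (R - {r}) = A - R" using that by auto
    ultimately show ?thesis by (simp add: w_def b_def)
  qed
  have "card (R <+> {..M}) \<le> CU.dim W"
  proof (rule CU.dual_family_card_le_dim[OF fs, where w = w and \<phi> = \<phi>])
    show "finite (R <+> {..M})" using finR by simp
    show "w i \<in> W" if "i \<in> R <+> {..M}" for i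
      using that wr omit mult R(1) by (auto simp: w_def f_def)
    show "Vector_Spaces.linear smult (*) (\<phi> i)" for i
      by (cases i; unfold_locales)
         (simp_all add: \<phi>_def poly_div_add_left div_smult_left)
    fix i j assume i: "i \<in> R <+> {..M}" and j: "j \<in> R <+> {..M}"
    show "\<phi> i (w j) = 0 \<longleftrightarrow> i \<noteq> j"
    proof (cases i; cases j)
      fix r r' assume ij: "i = Inl r" "j = Inl r'"
      then have "\<phi> i (w j) = (\<Prod>m\<in>R - {r'}. poly (fac m) (\<rho> r))"
        using b0 by (simp add: \<phi>_def w_def poly_prod)
      then show ?thesis using i j ij finR root by (auto simp: prod_zero_iff)
    next
      fix r k assume ij: "i = Inl r" "j = Inr k"
      then have "\<phi> i (w j) = poly ((\<Prod>m\<in>R. fac m) * monom 1 k) (\<rho> r)"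
        using b0 by (simp add: \<phi>_def w_def fb mult.assoc)
      then show ?thesis using i ij finR root by (auto simp: poly_prod prod_zero_iff)
    next
      fix k r assume ij: "i = Inr k" "j = Inl r"
      then have r: "r \<in> R" using j by auto
      have f: "f = fac r * w j"
        using prod.remove[of A r fac] r R(1) fin wr[OF r] ij by (auto simp: f_def)
      then have "fac r \<noteq> 0" "w j \<noteq> 0" using f0 by auto
      then have "degree f = degree (fac r) + degree (w j)"
        unfolding f by (rule degree_mult_eq)
      moreover have "degree (fac r) = 1" using nz[of r] r R(1) by (auto simp: fac_def)
      ultimately have "degree (w j) < degree f" by simp
      then show ?thesis using ij by (simp add: \<phi>_def div_poly_less)
    next
      fix k k' assume ij: "i = Inr k" "j = Inr k'"
      then show ?thesis using f0 by (simp add: \<phi>_def w_def)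
    qed
  qed
  then show ?thesis
    unfolding \<rho>_def[symmetric] using R(2,3) finR by (simp add: card_Plus card_image)
qed

text \<open>
  A family of lines together with coordinates on each of them. The line \<open>l\<close> has the equation \<open>a l\<close>
  and is parametrised by \<open>s \<mapsto> s (p l) + q l\<close>; the linear forms \<open>u l\<close> and \<open>v l\<close> are the
  coordinates dual to \<open>p l\<close> and \<open>q l\<close>, and \<open>n l\<close> is a direction transversal to the line. The
  condition \<open>separated\<close> says that \<open>p l\<close> lies on no other line; in particular, the lines are
  pairwise distinct.
\<close>

locale marked_lines =
  fixes L :: "'i set" and a p q u v n :: "'i \<Rightarrow> complex ^ 3"
  assumes finite_L: "finite L"
    and on_line: "\<And>l. l \<in> L \<Longrightarrow> dot3 (a l) (p l) = 0" "\<And>l. l \<in> L \<Longrightarrow> dot3 (a l) (q l) = 0"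
    and coords: "\<And>l. l \<in> L \<Longrightarrow> dot3 (u l) (p l) = 1" "\<And>l. l \<in> L \<Longrightarrow> dot3 (u l) (q l) = 0"
      "\<And>l. l \<in> L \<Longrightarrow> dot3 (v l) (p l) = 0" "\<And>l. l \<in> L \<Longrightarrow> dot3 (v l) (q l) = 1"
    and normal: "\<And>l. l \<in> L \<Longrightarrow> dot3 (a l) (n l) = 1"
    and expand: "\<And>l x. l \<in> L \<Longrightarrow> dot3 (a l) x = 0 \<Longrightarrow>
                  x = dot3 (u l) x *s p l + dot3 (v l) x *s q l"
    and separated: "\<And>l m. l \<in> L \<Longrightarrow> m \<in> L \<Longrightarrow> l \<noteq> m \<Longrightarrow> dot3 (a m) (p l) \<noteq> 0"
begin

abbreviation form :: "'i \<Rightarrow> S" where "form l \<equiv> linear_form (a l)"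

definition res :: "'i \<Rightarrow> S \<Rightarrow> complex poly" where "res l = restrict_line (p l) (q l)"

text \<open>
  The fields of degree \<open>N\<close> tangent to the lines in \<open>A\<close>. Tangency is expressed by restriction to the
  line; by the Nullstellensatz this is the divisibility of \<open>\<theta>(\<alpha>\<^sub>l)\<close> by \<open>\<alpha>\<^sub>l\<close>.
\<close>

definition Der :: "'i set \<Rightarrow> nat \<Rightarrow> (S ^ 3) set" where
  "Der A N = {\<theta> \<in> form_vecs N. \<forall>l\<in>A. res l (apply_field \<theta> (form l)) = 0}"

text \<open>
  The parameter on the line \<open>l\<close> of its intersection with the line \<open>m\<close>.
\<close>

definition crossing_param :: "'i \<Rightarrow> 'i \<Rightarrow> complex" where
  "crossing_param l m = - dot3 (a m) (q l) / dot3 (a m) (p l)"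

lemma res_form: "res l (form m) = [:dot3 (a m) (q l), dot3 (a m) (p l):]"
  by (simp add: res_def restrict_line_linear_form)

lemma res_form_self: "l \<in> L \<Longrightarrow> res l (form l) = 0"
  by (simp add: res_form on_line)

lemma linear_res: "Vector_Spaces.linear cscale_vec smult (\<lambda>\<theta>. res l (apply_field \<theta> f))"
  by unfold_locales
     (simp_all add: res_def VS.linear_add[OF linear_apply_field] VS.linear_scale[OF linear_apply_field]
        restrict_line_add restrict_line_cscale)

lemma subspace_Der: "CV.subspace (Der A N)"
  using subspace_form_vecs[of N]
  by (auto simp: Der_def CV.subspace_def VU.linear_0[OF linear_res] VU.linear_add[OF linear_res]
      VU.linear_scale[OF linear_res])

lemma finitely_spanned_Der: "CV.finitely_spanned (Der A N)"
  by (rule CV.finitely_spanned_subset[OF finitely_spanned_form_vecs]) (auto simp: Der_def)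

definition constant_field :: "S \<Rightarrow> complex ^ 3 \<Rightarrow> S ^ 3" where
  "constant_field g w = (\<chi> i. g * const (w $ i))"

lemma apply_constant_field: "apply_field (constant_field g w) (linear_form b) = g * const (dot3 b w)"
  by (simp add: constant_field_def apply_field_linear_form dot3_def const_add const_mult algebra_simps)

lemma constant_field_form_vecs: "homogeneous N g \<Longrightarrow> constant_field g w \<in> form_vecs N"
  using homogeneous_const_mult[of N g]
  by (simp add: constant_field_def form_vecs_def homogeneous_vec_def mult.commute)

text \<open>
  The kernel of \<open>\<theta> \<mapsto> \<theta>(\<alpha>\<^sub>H)|\<^sub>H\<close> on the fields tangent to \<open>A\<close> consists of the fields tangent to
  \<open>A \<union> {H}\<close>, so the dimension drops by the dimension of the image. A constant field \<open>w\<close> multiplied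
  by a form is tangent to each line whose equation divides the form, and also to each line that
  contains the direction \<open>w\<close>. So in the direction \<open>n H\<close> all forms of \<open>A\<close> are needed as factors,
  whereas in a direction along the line \<open>m\<close> the factor of \<open>m\<close> can be omitted. Both kinds of fields
  have the image required by \<open>dim_ge_products_of_linear_factors\<close>.
\<close>

lemma dim_Der_insert:
  assumes A: "A \<subseteq> L" and H: "H \<in> L" "H \<notin> A" and N: "card A \<le> N"
  shows "CV.dim (Der (insert H A) N) + (card (crossing_param H ` A) + (N - card A) + 1) \<le> CV.dim (Der A N)"
proof -
  define \<phi> where "\<phi> \<theta> = res H (apply_field \<theta> (form H))" for \<theta>
  have finA: "finite A" using A finite_L finite_subset by blast
  have lin: "Vector_Spaces.linear cscale_vec smult \<phi>"
    unfolding \<phi>_def [abs_def] by (rule linear_res)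
  have ker: "{\<theta> \<in> Der A N. \<phi> \<theta> = 0} = Der (insert H A) N"
    by (auto simp: Der_def \<phi>_def)
  note rn = VU.rank_nullity[OF lin subspace_Der[of A N] finitely_spanned_Der[of A N], unfolded ker]
  have nz: "dot3 (a m) (p H) \<noteq> 0" if "m \<in> A" for m
    using separated[of H m] that A H by auto
  have hom_form: "homogeneous 1 (form l)" for l by (rule homogeneous_linear_form)
  have "card ((\<lambda>m. - dot3 (a m) (q H) / dot3 (a m) (p H)) ` A) + (N - card A) + 1
          \<le> CU.dim (\<phi> ` Der A N)"
  proof (rule dim_ge_products_of_linear_factors[OF finA nz rn(2)], fold res_form)
    fix i assume i: "i \<le> N - card A"
    \<comment> \<open>\<open>u H\<close> and \<open>v H\<close> restrict to \<open>s\<close> and \<open>1\<close>, so this is a form of degree \<open>N - card A\<close> that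
      restricts to \<open>s\<^sup>i\<close>.\<close>
    define g where "g = linear_form (u H) ^ i * linear_form (v H) ^ (N - card A - i)"
    have res_g: "res H g = monom 1 i"
      using coords H(1) by (simp add: g_def res_def restrict_line_mult restrict_line_power
          restrict_line_linear_form monom_altdef flip: one_pCons)
    have "homogeneous (1 * i + 1 * (N - card A - i)) g"
      unfolding g_def by (intro homogeneous_mult homogeneous_power homogeneous_linear_form)
    moreover have "1 * i + 1 * (N - card A - i) = N - card A" using i by simp
    ultimately have hom_g: "homogeneous (N - card A) g" by metis
    define \<theta> where "\<theta> = constant_field (g * (\<Prod>m\<in>A. form m)) (n H)"
    have "homogeneous (N - card A + card A) (g * (\<Prod>m\<in>A. form m))"
      by (intro homogeneous_mult hom_g homogeneous_prod finA hom_form)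
    then have "\<theta> \<in> form_vecs N"
      unfolding \<theta>_def using N by (intro constant_field_form_vecs) simp
    moreover have "res l (apply_field \<theta> (form l)) = 0" if l: "l \<in> A" for l
    proof -
      have "res l (\<Prod>m\<in>A. form m) = 0"
        using l A finA res_form_self[of l] by (auto simp: res_def restrict_line_prod prod_zero_iff)
      then show ?thesis by (simp add: \<theta>_def apply_constant_field res_def restrict_line_mult)
    qed
    ultimately have "\<theta> \<in> Der A N" by (simp add: Der_def)
    moreover have "\<phi> \<theta> = (\<Prod>m\<in>A. res H (form m)) * monom 1 i"
      using normal[OF H(1)] res_g
      by (simp add: \<phi>_def \<theta>_def apply_constant_field res_def restrict_line_mult restrict_line_prod)
    ultimately show "(\<Prod>m\<in>A. res H (form m)) * monom 1 i \<in> \<phi> ` Der A N"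
      by (metis image_eqI)
  next
    fix m assume m: "m \<in> A"
    \<comment> \<open>A vector transversal to \<open>H\<close> and contained in the plane of \<open>m\<close>; it exists because \<open>p H\<close> is
      not on \<open>m\<close>.\<close>
    define w where "w = n H - (dot3 (a m) (n H) / dot3 (a m) (p H)) *s p H"
    have dot_w: "dot3 b w = dot3 b (n H) - dot3 (a m) (n H) / dot3 (a m) (p H) * dot3 b (p H)" for b
      by (simp add: w_def dot3_diff_right dot3_scale_right)
    have w: "dot3 (a m) w = 0" "dot3 (a H) w = 1"
      using nz[OF m] normal[OF H(1)] on_line(1)[OF H(1)] by (simp_all add: dot_w)
    define g where "g = linear_form (v H) ^ (N - card A + 1)"
    define \<theta> where "\<theta> = constant_field (g * (\<Prod>m'\<in>A - {m}. form m')) w"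
    have res_g: "res H g = 1"
      using coords H(1) by (simp add: g_def res_def restrict_line_mult restrict_line_power
          restrict_line_linear_form flip: one_pCons)
    have "homogeneous (1 * (N - card A + 1)) g"
      unfolding g_def by (intro homogeneous_power homogeneous_linear_form)
    then have "homogeneous (1 * (N - card A + 1) + card (A - {m})) (g * (\<Prod>m'\<in>A - {m}. form m'))"
      using finA by (intro homogeneous_mult homogeneous_prod hom_form) auto
    moreover have "1 * (N - card A + 1) + card (A - {m}) = N"
      using N m finA card_gt_0_iff[of A] by (auto simp: card_Diff_singleton)
    ultimately have "\<theta> \<in> form_vecs N"
      unfolding \<theta>_def by (intro constant_field_form_vecs) simp
    moreover have "res l (apply_field \<theta> (form l)) = 0" if l: "l \<in> A" for l
    proof (cases "l = m")
      case True
      then show ?thesis using w by (simp add: \<theta>_def apply_constant_field res_def)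
    next
      case False
      then have "res l (\<Prod>m'\<in>A - {m}. form m') = 0"
        using l A finA res_form_self[of l] by (auto simp: res_def restrict_line_prod prod_zero_iff)
      then show ?thesis by (simp add: \<theta>_def apply_constant_field res_def restrict_line_mult)
    qed
    ultimately have "\<theta> \<in> Der A N" by (simp add: Der_def)
    moreover have "\<phi> \<theta> = (\<Prod>m'\<in>A - {m}. res H (form m'))"
      using w res_g
      by (simp add: \<phi>_def \<theta>_def apply_constant_field res_def restrict_line_mult restrict_line_prod)
    ultimately show "(\<Prod>m'\<in>A - {m}. res H (form m')) \<in> \<phi> ` Der A N"
      by (metis image_eqI)
  qed
  then show ?thesis using rn(1) by (simp add: crossing_param_def [abs_def])
qed

section \<open>Points of multiplicity at least two\<close>

definition crossing_point :: "'i \<Rightarrow> 'i \<Rightarrow> (complex ^ 3) set" where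
  "crossing_point l m = vec.span {crossing_param l m *s p l + q l}"

lemma crossing_vector_nonzero: "l \<in> L \<Longrightarrow> c *s p l + q l \<noteq> 0"
proof
  assume l: "l \<in> L" and "c *s p l + q l = 0"
  then have "dot3 (v l) (c *s p l + q l) = 0" by (simp add: dot3_def)
  then show False using l coords by (simp add: dot3_add_right dot3_scale_right)
qed

lemma crossing_point_in_proj_plane: "l \<in> L \<Longrightarrow> crossing_point l m \<in> proj_plane"
  using crossing_vector_nonzero[of l "crossing_param l m"] by (simp add: proj_plane_def crossing_point_def)

lemma span_in_proj_line_iff:
  "vec.span {x} \<in> proj_plane \<Longrightarrow> vec.span {x} \<in> proj_line b \<longleftrightarrow> dot3 b x = 0"
proof -
  assume P: "vec.span {x} \<in> proj_plane"
  have "x \<in> vec.span {x}" by (simp add: vec.span_base)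
  moreover have "dot3 b y = 0" if "dot3 b x = 0" "y \<in> vec.span {x}" for y
    using that by (auto simp: vec.span_singleton dot3_scale_right)
  ultimately show ?thesis using P by (auto simp: proj_line_def dot3_def)
qed

lemma crossing_point_in_proj_lines:
  assumes "l \<in> L" "m \<in> L" "l \<noteq> m"
  shows "crossing_point l m \<in> proj_line (a l)" "crossing_point l m \<in> proj_line (a m)"
  using crossing_point_in_proj_plane[OF assms(1), of m] on_line[OF assms(1)] separated[OF assms]
  by (simp_all add: crossing_point_def span_in_proj_line_iff dot3_add_right dot3_scale_right crossing_param_def dot3_diff_right)

text \<open>
  The point is spanned by a vector \<open>x\<close> of the plane of \<open>l\<close>. Its coordinates \<open>(u l) x\<close> and \<open>(v l) x\<close>
  are in the ratio \<open>crossing_param l m\<close>, because \<open>x\<close> also satisfies the equation of \<open>m\<close>.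
\<close>

lemma crossing_point_unique:
  assumes l: "l \<in> L" and m: "m \<in> L" "l \<noteq> m" and P: "P \<in> proj_line (a l)" "P \<in> proj_line (a m)"
  shows "P = crossing_point l m"
proof -
  have sub: "vec.subspace P" and "vec.dim P = 1"
    using P(1) by (auto simp: proj_line_def proj_plane_def)
  moreover obtain B where B: "B \<subseteq> P" "vec.independent B" "P \<subseteq> vec.span B" "card B = vec.dim P"
    by (rule vec.basis_exists)
  ultimately obtain x where x: "B = {x}" by (auto simp: card_1_singleton_iff)
  have dots: "dot3 (a l) x = 0" "dot3 (a m) x = 0"
    using P B(1) x by (auto simp: proj_line_def dot3_def)
  let ?s = "dot3 (u l) x" and ?t = "dot3 (v l) x"
  have ex: "x = ?s *s p l + ?t *s q l" by (rule expand[OF l dots(1)])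
  then have "0 = ?s * dot3 (a m) (p l) + ?t * dot3 (a m) (q l)"
    using dots(2) by (metis dot3_add_right dot3_scale_right)
  then have s: "?s = ?t * crossing_param l m"
    using separated[OF l m] by (simp add: crossing_param_def field_simps eq_neg_iff_add_eq_0)
  then have xt: "x = ?t *s (crossing_param l m *s p l + q l)"
    using ex by (simp add: vec.scale_right_distrib)
  have "x \<noteq> 0" using B(2) x vec.dependent_zero[of B] by auto
  then have "?t \<noteq> 0" using xt by auto
  then have y: "crossing_param l m *s p l + q l = (1 / ?t) *s x"
    by (subst (2) xt) simp
  have "P = vec.span {x}"
    using B x sub vec.span_minimal[of "{x}" P] by auto
  also have "\<dots> = crossing_point l m"
    unfolding crossing_point_def
  proof (rule subset_antisym; rule vec.span_minimal; simp)
    show "x \<in> vec.span {crossing_param l m *s p l + q l}"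
      by (subst xt) (intro vec.span_scale vec.span_base, simp)
    show "crossing_param l m *s p l + q l \<in> vec.span {x}"
      unfolding y by (intro vec.span_scale vec.span_base) simp
  qed
  finally show ?thesis .
qed

definition crossings :: "(complex ^ 3) set set" where
  "crossings = (\<lambda>(l, m). crossing_point l m) ` {(l, m) \<in> L \<times> L. l \<noteq> m}"

lemma finite_crossings: "finite crossings"
  unfolding crossings_def using finite_L
  by (intro finite_imageI, intro finite_subset[of "{(l, m) \<in> L \<times> L. l \<noteq> m}" "L \<times> L"]) auto

definition mult_at :: "'i set \<Rightarrow> (complex ^ 3) set \<Rightarrow> nat" where
  "mult_at A P = card {l \<in> A. P \<in> proj_line (a l)}"

lemma multiple_point_is_crossing:
  assumes "2 \<le> mult_at L P"
  shows "P \<in> crossings"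
proof -
  obtain l m where lm: "l \<in> L" "m \<in> L" "l \<noteq> m" "P \<in> proj_line (a l)" "P \<in> proj_line (a m)"
    using assms unfolding mult_at_def
    by (auto simp: numeral_2_eq_2 card_le_Suc_iff)
  then show ?thesis using crossing_point_unique[OF lm] by (auto simp: crossings_def)
qed

lemma crossing_mult_at:
  assumes "P \<in> crossings"
  shows "2 \<le> mult_at L P" "P \<in> proj_plane"
proof -
  obtain l m where lm: "l \<in> L" "m \<in> L" "l \<noteq> m" "P = crossing_point l m"
    using assms by (auto simp: crossings_def)
  then have "{l, m} \<subseteq> {l \<in> L. P \<in> proj_line (a l)}"
    using crossing_point_in_proj_lines[of l m] by auto
  then have "card {l, m} \<le> mult_at L P"
    unfolding mult_at_def using finite_L by (intro card_mono) auto
  then show "2 \<le> mult_at L P" using lm by simp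
  show "P \<in> proj_plane" using lm crossing_point_in_proj_plane by simp
qed

text \<open>
  This is \<open>\<Sum>\<^sub>P (r\<^sub>P - 1 choose 2)\<close>. The sum is over the crossings of the whole family \<open>L\<close>, so that
  the range does not change while lines are added to \<open>A\<close>; a point on at most two lines of \<open>A\<close>
  contributes \<open>0\<close>.
\<close>

definition excess :: "'i set \<Rightarrow> nat" where
  "excess A = (\<Sum>P\<in>crossings. (mult_at A P - 1) choose 2)"

text \<open>
  A crossing on \<open>H\<close> that lies on \<open>r \<ge> 1\<close> lines of \<open>A\<close> contributes
  \<open>(r choose 2) - (r - 1 choose 2) = r - 1\<close> to the growth. Every line of \<open>A\<close> passes through one of
  these points, so the \<open>r\<close> sum up to at least \<open>card A\<close>, and the number of points is at most the
  number of parameters.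
\<close>

lemma excess_insert:
  assumes A: "A \<subseteq> L" and H: "H \<in> L" "H \<notin> A"
  shows "excess A + card A \<le> excess (insert H A) + card (crossing_param H ` A)"
proof -
  have finA: "finite A" using A finite_L finite_subset by blast
  define Y where "Y = crossing_point H ` A"
  have Y: "Y \<subseteq> crossings"
    using A H by (auto simp: Y_def crossings_def image_iff)
  have finY: "finite Y" using finA by (simp add: Y_def)
  have "Y = (\<lambda>c. vec.span {c *s p H + q H}) ` (crossing_param H ` A)"
    by (simp add: Y_def crossing_point_def image_image)
  then have cardY: "card Y \<le> card (crossing_param H ` A)"
    using finA by (simp add: card_image_le)
  have fin: "finite {l \<in> A. P \<in> proj_line (a l)}" for P using finA by simp
  have mult_H: "mult_at (insert H A) P = mult_at A P + 1" if "P \<in> proj_line (a H)" for P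
  proof -
    have "{l \<in> insert H A. P \<in> proj_line (a l)} = insert H {l \<in> A. P \<in> proj_line (a l)}"
      using that by auto
    then show ?thesis using H(2) fin by (simp add: mult_at_def)
  qed
  have mono: "(mult_at A P - 1) choose 2 \<le> (mult_at (insert H A) P - 1) choose 2" for P
  proof -
    have "mult_at A P \<le> mult_at (insert H A) P"
      unfolding mult_at_def using finA by (intro card_mono) auto
    then have "mult_at A P - 1 \<le> mult_at (insert H A) P - 1" by simp
    then show ?thesis unfolding choose_two by (intro div_le_mono mult_le_mono) auto
  qed
  have step: "((mult_at A P - 1) choose 2) + mult_at A P = ((mult_at (insert H A) P - 1) choose 2) + 1"
    if PY: "P \<in> Y" for P
  proof -
    obtain m where m: "m \<in> A" "P = crossing_point H m" using PY by (auto simp: Y_def)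
    have P: "P \<in> proj_line (a H)" "P \<in> proj_line (a m)"
      using crossing_point_in_proj_lines[of H m] m A H by auto
    then have "mult_at A P \<noteq> 0" using m(1) finA by (auto simp: mult_at_def)
    then obtain r where "mult_at A P = Suc r" by (cases "mult_at A P") auto
    then show ?thesis
      using mult_H[OF P(1)] by (simp add: numeral_2_eq_2)
  qed
  have "card A \<le> card (\<Union>P\<in>Y. {l \<in> A. P \<in> proj_line (a l)})"
    using A H crossing_point_in_proj_lines(2)[OF H(1)] finA
    by (intro card_mono) (auto simp: Y_def)
  also have "\<dots> \<le> (\<Sum>P\<in>Y. mult_at A P)"
    unfolding mult_at_def by (rule card_UN_le[OF finY])
  finally have cardA: "card A \<le> (\<Sum>P\<in>Y. mult_at A P)" .
  let ?t = "\<lambda>P. (mult_at A P - 1) choose 2" and ?t' = "\<lambda>P. (mult_at (insert H A) P - 1) choose 2"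
  have "excess A + card A \<le> (\<Sum>P\<in>crossings - Y. ?t P) + (\<Sum>P\<in>Y. ?t P + mult_at A P)"
    unfolding excess_def sum.subset_diff[OF Y finite_crossings, of ?t] sum.distrib using cardA by simp
  also have "(\<Sum>P\<in>Y. ?t P + mult_at A P) = (\<Sum>P\<in>Y. ?t' P + 1)"
    by (intro sum.cong refl step)
  also have "\<dots> = (\<Sum>P\<in>Y. ?t' P) + card Y"
    by (subst sum.distrib) simp
  also have "(\<Sum>P\<in>crossings - Y. ?t P) + \<dots> \<le> (\<Sum>P\<in>crossings - Y. ?t' P) + ((\<Sum>P\<in>Y. ?t' P) + card Y)"
    by (intro add_right_mono sum_mono mono)
  also have "\<dots> = excess (insert H A) + card Y"
    unfolding excess_def sum.subset_diff[OF Y finite_crossings, of ?t'] by simp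
  finally show ?thesis using cardY by simp
qed

text \<open>
  Induction on the number of lines. The steps \<open>dim_Der_insert\<close> and \<open>excess_insert\<close> both involve the
  number of crossings on the new line, which cancels.
\<close>

lemma dim_Der_le:
  assumes "A \<subseteq> L" "card L \<le> N"
  shows "CV.dim (Der A N) + card A * (N + 1) \<le> 3 * card (exponents N) + excess A"
proof -
  have "finite A" using assms(1) finite_L finite_subset by blast
  then show ?thesis using assms(1)
  proof (induction A rule: finite_induct)
    case empty
    have "Der {} N = form_vecs N" by (auto simp: Der_def)
    then show ?case by (simp add: dim_form_vecs)
  next
    case (insert H A)
    have N: "card A \<le> N"
      using card_mono[OF finite_L, of A] insert.prems assms(2) by auto
    show ?case
      using dim_Der_insert[of A H N] excess_insert[of A H] insert N by (auto simp: algebra_simps)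
  qed
qed

section \<open>Syzygies of the partial derivatives\<close>

abbreviation equation :: S where "equation \<equiv> \<Prod>l\<in>L. form l"

text \<open>
  Expand \<open>0 = \<theta>(f)\<close> by the product rule and restrict to \<open>l\<close>. Only the term in which \<open>\<alpha>\<^sub>l\<close> is
  differentiated survives, and its other factors do not vanish on \<open>l\<close>.
\<close>

lemma AR_subset_Der: "AR equation \<inter> form_vecs N \<subseteq> Der L N"
proof
  fix \<theta> assume \<theta>: "\<theta> \<in> AR equation \<inter> form_vecs N"
  have "res l (apply_field \<theta> (form l)) = 0" if l: "l \<in> L" for l
  proof -
    have "0 = res l (\<Sum>m\<in>L. apply_field \<theta> (form m) * (\<Prod>m'\<in>L - {m}. form m'))"
      using \<theta> derivation_prod[OF derivation_apply_field finite_L, of \<theta> form]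
      by (simp add: AR_eq res_def)
    also have "\<dots> = (\<Sum>m\<in>L. if m = l then
        res l (apply_field \<theta> (form l)) * (\<Prod>m'\<in>L - {l}. res l (form m')) else 0)"
      unfolding res_def restrict_line_sum restrict_line_mult restrict_line_prod
    proof (intro sum.cong refl)
      fix m assume "m \<in> L"
      show "restrict_line (p l) (q l) (apply_field \<theta> (form m)) *
          (\<Prod>m'\<in>L - {m}. restrict_line (p l) (q l) (form m')) =
        (if m = l then restrict_line (p l) (q l) (apply_field \<theta> (form l)) *
          (\<Prod>m'\<in>L - {l}. restrict_line (p l) (q l) (form m')) else 0)"
        using finite_L l res_form_self[OF l] by (auto simp: res_def)
    qed
    finally have "res l (apply_field \<theta> (form l)) * (\<Prod>m'\<in>L - {l}. res l (form m')) = 0"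
      using finite_L l by simp
    moreover have "(\<Prod>m'\<in>L - {l}. res l (form m')) \<noteq> 0"
      using finite_L separated[OF l] by (auto simp: prod_zero_iff res_form)
    ultimately show ?thesis by simp
  qed
  then show "\<theta> \<in> Der L N" using \<theta> by (simp add: Der_def)
qed

lemma equation_nonzero: "equation \<noteq> 0"
proof -
  have "form l \<noteq> 0" if "l \<in> L" for l
  proof
    assume "form l = 0"
    then have "const (a l $ 1) = 0" "const (a l $ 2) = 0" "const (a l $ 3) = 0"
      using partial_linear_form[of "a l"] derivation_partial by (simp_all add: derivation_0)
    then show False using normal[OF that] by (simp add: dot3_def)
  qed
  then show ?thesis using finite_L by (simp add: prod_zero_iff)
qed

text \<open>
  On the tangent fields, \<open>AR(f)\<close> is the kernel of \<open>\<theta> \<mapsto> \<theta>(f)\<close>, and the image contains all multiples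
  of \<open>f\<close>: the field \<open>g \<theta>\<^sub>E\<close> is tangent to every line and is mapped to \<open>d g f\<close>.
\<close>

lemma dim_AR_euler_le:
  assumes "L \<noteq> {}"
  shows "CV.dim (AR equation \<inter> form_vecs (N + 1)) + card (exponents N) \<le> CV.dim (Der L (N + 1))"
proof -
  let ?E = "\<lambda>\<theta>. apply_field \<theta> equation" and ?D = "Der L (N + 1)"
  have ker: "{\<theta> \<in> ?D. ?E \<theta> = 0} = AR equation \<inter> form_vecs (N + 1)"
    using AR_subset_Der[of "N + 1"] by (auto simp: AR_eq Der_def)
  note rn = VS.rank_nullity[OF linear_apply_field[of equation] subspace_Der[of L "N + 1"]
      finitely_spanned_Der, unfolded ker]
  define c :: S where "c = of_nat (card L) * equation"
  have c0: "c \<noteq> 0"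
    using equation_nonzero assms finite_L by (simp add: c_def)
  have lin: "Vector_Spaces.linear cscale cscale (\<lambda>g. g * c)"
    by unfold_locales (simp_all add: cscale_def algebra_simps)
  have "(\<lambda>g. g * c) ` forms N \<subseteq> ?E ` ?D"
  proof (rule image_subsetI)
    fix g assume g: "g \<in> forms N"
    have "homogeneous (N + 1) (g * euler $ i)" for i
      using g homogeneous_euler by (intro homogeneous_mult) (auto simp: forms_def homogeneous_vec_def)
    then have "g *s euler \<in> ?D"
      by (simp add: Der_def form_vecs_def homogeneous_vec_def apply_field_scale euler_linear_form
          res_def restrict_line_mult) (simp add: res_form_self flip: res_def)
    moreover have "?E (g *s euler) = g * c"
      by (simp add: apply_field_scale euler_prod_linear_forms[OF finite_L] c_def)
    ultimately show "g * c \<in> ?E ` ?D" by (metis image_eqI)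
  qed
  then have "CS.dim ((\<lambda>g. g * c) ` forms N) \<le> CS.dim (?E ` ?D)"
    by (rule CS.dim_mono_finitely_spanned[OF rn(2)])
  moreover have "CS.dim ((\<lambda>g. g * c) ` forms N) = card (exponents N)"
    using SS.dim_image_inj[OF lin subspace_forms finitely_spanned_forms, of N] c0 by (simp add: dim_forms)
  ultimately show ?thesis using rn(1) by simp
qed

text \<open>
  The image of \<open>\<theta> \<mapsto> \<theta>(f)\<close> consists of forms of degree \<open>N + d - 1\<close>.
\<close>

lemma dim_AR_ge:
  assumes "L \<noteq> {}"
  shows "3 * card (exponents N) \<le>
           CV.dim (AR equation \<inter> form_vecs N) + card (exponents (N + card L - 1))"
proof -
  let ?E = "\<lambda>\<theta>. apply_field \<theta> equation"
  have ker: "{\<theta> \<in> form_vecs N. ?E \<theta> = 0} = AR equation \<inter> form_vecs N"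
    by (auto simp: AR_eq)
  note rn = VS.rank_nullity(1)[OF linear_apply_field[of equation] subspace_form_vecs[of N]
      finitely_spanned_form_vecs, unfolded ker]
  have "?E ` form_vecs N \<subseteq> forms (N + card L - 1)"
    using apply_field_prod_homogeneous[OF _ finite_L assms] by auto
  then have "CS.dim (?E ` form_vecs N) \<le> card (exponents (N + card L - 1))"
    using CS.dim_mono_finitely_spanned[OF finitely_spanned_forms] dim_forms by metis
  then show ?thesis using rn by (simp add: dim_form_vecs)
qed

end

section \<open>Parametrisation of the lines\<close>

definition cross :: "complex ^ 3 \<Rightarrow> complex ^ 3 \<Rightarrow> complex ^ 3" where
  "cross x y = vector [x $ 2 * y $ 3 - x $ 3 * y $ 2, x $ 3 * y $ 1 - x $ 1 * y $ 3,
                       x $ 1 * y $ 2 - x $ 2 * y $ 1]"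

lemma cross_components:
  "cross x y $ 1 = x $ 2 * y $ 3 - x $ 3 * y $ 2" "cross x y $ 2 = x $ 3 * y $ 1 - x $ 1 * y $ 3"
  "cross x y $ 3 = x $ 1 * y $ 2 - x $ 2 * y $ 1"
  by (simp_all add: cross_def)

lemma exists_dot3_eq_1:
  assumes "x \<noteq> 0"
  shows "\<exists>c. dot3 x c = 1"
proof -
  obtain i where i: "x $ i \<noteq> 0" using assms by (auto simp: vec_eq_iff)
  have "dot3 x (axis i (1 / x $ i)) = 1"
    using i exhaust_3[of i] by (auto simp: dot3_def axis_def)
  then show ?thesis by blast
qed

text \<open>
  If the cross product vanishes, then all \<open>2 \<times> 2\<close> minors of the pair do, so the two equations are
  proportional.
\<close>

lemma proj_line_eq_if_cross_eq_0:
  assumes "cross x y = 0" "x \<noteq> 0" "y \<noteq> 0"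
  shows "proj_line x = proj_line y"
proof -
  have *: "dot3 x w = 0" if xy: "cross x y = 0" "y \<noteq> 0" "dot3 y w = 0" for x y w :: "complex ^ 3"
  proof -
    have minors: "x $ i * y $ j = x $ j * y $ i" for i j
      using xy(1) exhaust_3[of i] exhaust_3[of j]
      by (auto simp: vec_eq_iff forall_3 cross_components)
    obtain j where "y $ j \<noteq> 0" using xy(2) by (auto simp: vec_eq_iff)
    moreover have "dot3 x w * y $ j = (x $ 1 * y $ j) * w $ 1 + (x $ 2 * y $ j) * w $ 2 + (x $ 3 * y $ j) * w $ 3"
      by (simp add: dot3_def algebra_simps)
    then have "dot3 x w * y $ j = x $ j * dot3 y w"
      unfolding minors[of 1 j] minors[of 2 j] minors[of 3 j] by (simp add: dot3_def algebra_simps)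
    ultimately show ?thesis using xy(3) by simp
  qed
  have "cross y x = - cross x y"
    by (simp add: vec_eq_iff forall_3 cross_components)
  then have "cross y x = 0" using assms(1) by simp
  then have "dot3 x w = 0 \<longleftrightarrow> dot3 y w = 0" for w
    using * assms by blast
  then show ?thesis by (simp add: proj_line_def dot3_def)
qed

text \<open>
  The vectors of the plane \<open>\<alpha> = 0\<close> are the cross products with \<open>\<alpha>\<close>. Take \<open>p = \<alpha> \<times> b\<close> and
  \<open>q = \<alpha> \<times> c\<close> with \<open>det (\<alpha>, b, c) = 1\<close>; then \<open>c\<close> and \<open>- b\<close> are the dual coordinates. Because
  \<open>\<beta> \<cdot> p = (\<beta> \<times> \<alpha>) \<cdot> b\<close>, the point \<open>p\<close> avoids the lines in \<open>F\<close> if \<open>b\<close> avoids finitely many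
  planes. The curve \<open>t \<mapsto> (1, t, t\<^sup>2)\<close> meets each of these planes in finitely many points.
\<close>

lemma exists_marking:
  assumes \<alpha>: "\<alpha> \<noteq> 0" and F: "finite F" "\<And>\<beta>. \<beta> \<in> F \<Longrightarrow> cross \<beta> \<alpha> \<noteq> 0"
  shows "\<exists>p q u v n. dot3 \<alpha> p = 0 \<and> dot3 \<alpha> q = 0 \<and> dot3 u p = 1 \<and> dot3 u q = 0 \<and>
           dot3 v p = 0 \<and> dot3 v q = 1 \<and> dot3 \<alpha> n = 1 \<and>
           (\<forall>x. dot3 \<alpha> x = 0 \<longrightarrow> x = dot3 u x *s p + dot3 v x *s q) \<and>
           (\<forall>\<beta>\<in>F. dot3 \<beta> p \<noteq> 0)"
proof -
  define b :: "complex \<Rightarrow> complex ^ 3" where "b t = vector [1, t, t ^ 2]" for t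
  have "\<exists>\<eta>. cross \<eta> \<alpha> \<noteq> 0"
  proof (rule ccontr)
    assume "\<not> ?thesis"
    then have "cross (vector [1, 0, 0]) \<alpha> = 0" "cross (vector [0, 1, 0]) \<alpha> = 0" by auto
    then show False using \<alpha> by (auto simp: vec_eq_iff forall_3 cross_components)
  qed
  \<comment> \<open>The auxiliary vector \<open>\<eta>\<close> forces \<open>p \<noteq> 0\<close>, also if \<open>F\<close> is empty.\<close>
  then obtain \<eta> where \<eta>: "cross \<eta> \<alpha> \<noteq> 0" by blast
  have fin: "finite {t. dot3 c (b t) = 0}" if "c \<noteq> 0" for c
  proof -
    have "dot3 c (b t) = poly [:c $ 1, c $ 2, c $ 3:] t" for t
      by (simp add: dot3_def b_def power2_eq_square algebra_simps)
    moreover have "[:c $ 1, c $ 2, c $ 3:] \<noteq> 0"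
      using that by (auto simp: vec_eq_iff forall_3)
    ultimately show ?thesis using poly_roots_finite[of "[:c $ 1, c $ 2, c $ 3:]"] by simp
  qed
  have "finite (\<Union>\<beta>\<in>insert \<eta> F. {t. dot3 (cross \<beta> \<alpha>) (b t) = 0})"
    using F \<eta> fin by auto
  then obtain t where t: "t \<notin> (\<Union>\<beta>\<in>insert \<eta> F. {t. dot3 (cross \<beta> \<alpha>) (b t) = 0})"
    using infinite_UNIV_char_0[where 'a = complex] ex_new_if_finite by blast
  define p where "p = cross \<alpha> (b t)"
  have dot_p: "dot3 \<beta> p = dot3 (cross \<beta> \<alpha>) (b t)" for \<beta>
    by (simp add: p_def dot3_def cross_components algebra_simps)
  have "dot3 \<eta> p \<noteq> 0" using t by (simp add: dot_p)
  then have "p \<noteq> 0" by (auto simp: dot3_def)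
  then obtain c where c: "dot3 p c = 1" using exists_dot3_eq_1 by blast
  obtain n where n: "dot3 \<alpha> n = 1" using exists_dot3_eq_1[OF \<alpha>] by blast
  define q where "q = cross \<alpha> c"
  have "x = dot3 c x *s p + dot3 (- b t) x *s q" if "dot3 \<alpha> x = 0" for x
  proof -
    \<comment> \<open>The expansion of \<open>x\<close> in the basis dual to \<open>\<alpha>, b, c\<close>, multiplied by their determinant \<open>p \<cdot> c\<close>.\<close>
    have "dot3 p c *s x = dot3 \<alpha> x *s cross (b t) c + dot3 c x *s p + dot3 (- b t) x *s q"
      by (simp add: vec_eq_iff forall_3 p_def q_def dot3_def cross_components algebra_simps)
    then show ?thesis using c that by simp
  qed
  moreover have "dot3 (- b t) q = dot3 p c"
    by (simp add: p_def q_def dot3_def cross_components algebra_simps)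
  moreover have "dot3 c p = dot3 p c" by (simp add: dot3_def algebra_simps)
  moreover have "dot3 \<alpha> p = 0" "dot3 \<alpha> q = 0" "dot3 c q = 0" "dot3 (- b t) p = 0"
    by (simp_all add: p_def q_def dot3_def cross_components algebra_simps)
  moreover have "\<forall>\<beta>\<in>F. dot3 \<beta> p \<noteq> 0" using t by (simp add: dot_p)
  ultimately show ?thesis using c n by metis
qed

lemma exists_marked_lines:
  assumes fin: "finite L" and a: "\<And>l. l \<in> L \<Longrightarrow> a l \<noteq> 0 \<and> proj_line (a l) = l"
  shows "\<exists>p q u v n. marked_lines L a p q u v n"
proof -
  define Q where "Q l p q u v n \<longleftrightarrow>
    dot3 (a l) p = 0 \<and> dot3 (a l) q = 0 \<and> dot3 u p = 1 \<and> dot3 u q = 0 \<and>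
    dot3 v p = 0 \<and> dot3 v q = 1 \<and> dot3 (a l) n = 1 \<and>
    (\<forall>x. dot3 (a l) x = 0 \<longrightarrow> x = dot3 u x *s p + dot3 v x *s q) \<and>
    (\<forall>\<beta>\<in>a ` (L - {l}). dot3 \<beta> p \<noteq> 0)" for l p q u v n
  have "\<exists>p q u v n. Q l p q u v n" if l: "l \<in> L" for l
    unfolding Q_def
  proof (rule exists_marking)
    show "a l \<noteq> 0" using a[OF l] by blast
    show "finite (a ` (L - {l}))" using fin by simp
    show "cross \<beta> (a l) \<noteq> 0" if \<beta>: "\<beta> \<in> a ` (L - {l})" for \<beta>
    proof
      assume 0: "cross \<beta> (a l) = 0"
      obtain m where "m \<in> L" "m \<noteq> l" "\<beta> = a m" using \<beta> by auto
      then show False using proj_line_eq_if_cross_eq_0[OF 0] a l by metis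
    qed
  qed
  then obtain p q u v n where Q: "\<And>l. l \<in> L \<Longrightarrow> Q l (p l) (q l) (u l) (v l) (n l)"
    by metis
  have "marked_lines L a p q u v n"
  proof
    show "x = dot3 (u l) x *s p l + dot3 (v l) x *s q l" if "l \<in> L" "dot3 (a l) x = 0" for l x
      using Q[OF that(1)] that(2) unfolding Q_def by blast
    show "dot3 (a m) (p l) \<noteq> 0" if "l \<in> L" "m \<in> L" "l \<noteq> m" for l m
      using Q[OF that(1)] that unfolding Q_def by blast
  qed (use fin Q in \<open>auto simp: Q_def\<close>)
  then show ?thesis by blast
qed

section \<open>The numerical comparison\<close>

lemma nonneg_slope:
  fixes e c :: real
  assumes "\<And>N :: nat. 0 \<le> e * N + c"
  shows "0 \<le> e"
proof (rule ccontr)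
  assume "\<not> 0 \<le> e"
  then obtain N :: nat where "c < real N * (- e)"
    using reals_Archimedean3[of "- e"] by auto
  then show False using assms[of N] by (simp add: algebra_simps)
qed

text \<open>
  Both hypotheses are linear inequalities in \<open>N\<close>, with opposite slopes \<open>\<plusminus> 2 (d - 1 - a - b)\<close>. Hence
  the slopes are zero, and the constant term of the second inequality gives
  \<open>a\<^sup>2 + b\<^sup>2 \<le> 2 T + d - 1\<close>.
\<close>

lemma discriminant_bound:
  fixes a b d T :: real
  assumes lower: "\<And>N :: nat. let K = a + b + d + N in
      3 * ((K + 1) * (K + 2)) \<le> (K - a + 1) * (K - a + 2) + (K - b + 1) * (K - b + 2) + (K + d) * (K + d + 1)"
    and upper: "\<And>N :: nat. let K = a + b + d + N in
      (K - a + 1) * (K - a + 2) + (K - b + 1) * (K - b + 2) + K * (K + 1) + 2 * d * (K + 1)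
        \<le> 3 * ((K + 1) * (K + 2)) + 2 * T"
  shows "(d - 1) * (d - 3) / 4 \<le> T"
proof -
  define c1 where "c1 = (1 - a) * (2 - a) + (1 - b) * (2 - b) + d * (d + 1) - 6"
  define c2 where "c2 = 6 + 2 * T - (1 - a) * (2 - a) - (1 - b) * (2 - b) - 2 * d"
  define e where "e = 2 * (d - 1 - a - b)"
  have *: "0 \<le> e * N + (e * (a + b + d) + c1)" "0 \<le> - e * N + (- e * (a + b + d) + c2)" for N :: nat
    using lower[of N] upper[of N]
    by (simp_all add: Let_def c1_def c2_def e_def algebra_simps)
  have e0: "e = 0" using nonneg_slope[OF *(1)] nonneg_slope[OF *(2)] by simp
  then have c2: "0 \<le> c2" using *(2)[of 0] by simp
  have d: "d = a + b + 1" using e0 by (simp add: e_def)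
  have "0 \<le> (a - b)\<^sup>2" by simp
  then show ?thesis using c2 unfolding c2_def d by (simp add: power2_eq_square algebra_simps)
qed


context marked_lines begin

text \<open>
  The degree \<open>K\<close> exceeds \<open>b\<^sub>1 + b\<^sub>2\<close>, as needed for the graded piece of the free module, and it is at
  least the number of lines, as needed for the upper bound on the tangent fields.
\<close>

lemma excess_lower_bound:
  assumes indep: "S3.independent {\<theta>, \<eta>}" "\<theta> \<noteq> \<eta>"
    and hom: "homogeneous_vec b\<^sub>1 \<theta>" "homogeneous_vec b\<^sub>2 \<eta>"
    and span: "S3.span {\<theta>, \<eta>} = AR equation" and L: "L \<noteq> {}"
  shows "(real (card L) - 1) * (real (card L) - 3) / 4 \<le> real (excess L)"
proof (rule discriminant_bound[of b\<^sub>1 b\<^sub>2])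
  fix N :: nat
  let ?d = "card L"
  define K where "K = b\<^sub>1 + b\<^sub>2 + ?d + N"
  have d: "?d \<ge> 1" using L finite_L by (simp add: Suc_le_eq card_gt_0_iff)
  have card_real: "2 * real (card (exponents n)) = (real n + 1) * (real n + 2)" for n
    using card_exponents[of n] by (metis of_nat_1 of_nat_add of_nat_mult of_nat_numeral)
  have dim_AR: "CV.dim (AR equation \<inter> form_vecs K) =
      card (exponents (b\<^sub>2 + ?d + N)) + card (exponents (b\<^sub>1 + ?d + N))"
    using dim_graded_piece_free_rank_2[OF indep hom, of "?d + N"] by (simp add: span K_def ac_simps)
  have t1: "2 * real (card (exponents (b\<^sub>2 + ?d + N))) = (real K - b\<^sub>1 + 1) * (real K - b\<^sub>1 + 2)"
    and t2: "2 * real (card (exponents (b\<^sub>1 + ?d + N))) = (real K - b\<^sub>2 + 1) * (real K - b\<^sub>2 + 2)"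
    by (simp_all add: card_real K_def algebra_simps)
  have t3: "2 * real (card (exponents (K + ?d - 1))) = (real K + ?d) * (real K + ?d + 1)"
    using d by (simp add: card_real of_nat_diff)
  have t4: "2 * real (card (exponents (K - 1))) = real K * (real K + 1)"
    using d by (simp add: card_real of_nat_diff K_def)
  have "3 * card (exponents K) \<le> card (exponents (b\<^sub>2 + ?d + N)) + card (exponents (b\<^sub>1 + ?d + N))
      + card (exponents (K + ?d - 1))"
    using dim_AR_ge[OF L, of K] dim_AR by simp
  then have "3 * (2 * real (card (exponents K))) \<le> 2 * real (card (exponents (b\<^sub>2 + ?d + N)))
      + 2 * real (card (exponents (b\<^sub>1 + ?d + N))) + 2 * real (card (exponents (K + ?d - 1)))"
    by linarith
  then have "3 * ((real K + 1) * (real K + 2)) \<le> (real K - b\<^sub>1 + 1) * (real K - b\<^sub>1 + 2)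
      + (real K - b\<^sub>2 + 1) * (real K - b\<^sub>2 + 2) + (real K + ?d) * (real K + ?d + 1)"
    unfolding card_real[of K] t1 t2 t3 .
  then show "let K = real b\<^sub>1 + real b\<^sub>2 + real ?d + real N in
      3 * ((K + 1) * (K + 2)) \<le> (K - b\<^sub>1 + 1) * (K - b\<^sub>1 + 2) + (K - b\<^sub>2 + 1) * (K - b\<^sub>2 + 2)
        + (K + ?d) * (K + ?d + 1)"
    by (simp add: Let_def K_def)
  have "K - 1 + 1 = K" using d by (simp add: K_def)
  then have "CV.dim (AR equation \<inter> form_vecs K) + card (exponents (K - 1)) + ?d * (K + 1)
      \<le> 3 * card (exponents K) + excess L"
    using dim_AR_euler_le[OF L, of "K - 1"] dim_Der_le[of L K] by (simp add: K_def)
  then have "real (card (exponents (b\<^sub>2 + ?d + N)) + card (exponents (b\<^sub>1 + ?d + N)) + card (exponents (K - 1))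
      + ?d * (K + 1)) \<le> real (3 * card (exponents K) + excess L)"
    unfolding dim_AR by (simp only: of_nat_le_iff)
  then have "2 * real (card (exponents (b\<^sub>2 + ?d + N))) + 2 * real (card (exponents (b\<^sub>1 + ?d + N)))
      + 2 * real (card (exponents (K - 1))) + 2 * real ?d * (real K + 1)
      \<le> 3 * (2 * real (card (exponents K))) + 2 * real (excess L)"
    by (simp add: algebra_simps)
  then have "(real K - b\<^sub>1 + 1) * (real K - b\<^sub>1 + 2) + (real K - b\<^sub>2 + 1) * (real K - b\<^sub>2 + 2)
      + real K * (real K + 1) + 2 * real ?d * (real K + 1)
      \<le> 3 * ((real K + 1) * (real K + 2)) + 2 * real (excess L)"
    unfolding card_real[of K] t1 t2 t4 .
  then show "let K = real b\<^sub>1 + real b\<^sub>2 + real ?d + real N in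
      (K - b\<^sub>1 + 1) * (K - b\<^sub>1 + 2) + (K - b\<^sub>2 + 1) * (K - b\<^sub>2 + 2) + K * (K + 1) + 2 * real ?d * (K + 1)
        \<le> 3 * ((K + 1) * (K + 2)) + 2 * real (excess L)"
    by (simp add: Let_def K_def)
qed

end

text \<open>
  Marked lines that are indexed by themselves, as in an arrangement.
\<close>

locale marked_arrangement = marked_lines L a p q u v n
  for L :: "(complex ^ 3) set set set" and a p q u v n +
  assumes proj_line_form: "\<And>l. l \<in> L \<Longrightarrow> proj_line (a l) = l"

text \<open>
  Since \<open>max_multiplicity\<close> and \<open>num_points\<close> are defined through cardinalities of sets, finiteness of
  the set of crossings enters: only then does a crossing on \<open>r\<close> lines make \<open>num_points L r\<close>
  nonzero, which gives \<open>r \<le> 4\<close>. The values \<open>r = 2, 3, 4\<close> contribute \<open>0, 1, 3\<close>.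
\<close>

lemma (in marked_arrangement) excess_le_num_points:
  assumes max: "max_multiplicity L = 4"
  shows "excess L \<le> num_points L 3 + 3 * num_points L 4"
proof -
  have mult: "mult_at L P = card {l \<in> L. P \<in> l}" for P
    unfolding mult_at_def using proj_line_form by (intro arg_cong[where f = card]) auto
  have points: "num_points L r = card {P \<in> crossings. mult_at L P = r}" if "2 \<le> r" for r
    unfolding num_points_def mult[symmetric]
    using that multiple_point_is_crossing crossing_mult_at by (intro arg_cong[where f = card]) auto
  have le4: "mult_at L P \<le> 4" if P: "P \<in> crossings" for P
  proof -
    let ?R = "{r. 2 \<le> r \<and> num_points L r \<noteq> 0}"
    have "?R \<subseteq> {..card L}"
    proof
      fix r assume "r \<in> ?R"
      then obtain P where "card {l \<in> L. P \<in> l} = r"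
        unfolding num_points_def by (metis (mono_tags, lifting) card_eq_0_iff ex_in_conv mem_Collect_eq)
      then show "r \<in> {..card L}" using card_mono[OF finite_L, of "{l \<in> L. P \<in> l}"] by auto
    qed
    moreover have "mult_at L P \<in> ?R"
      using P crossing_mult_at(1)[OF P] finite_crossings by (auto simp: points card_gt_0_iff)
    ultimately show ?thesis
      using max Max_ge[of ?R "mult_at L P"] finite_subset[of ?R "{..card L}"]
      by (simp add: max_multiplicity_def)
  qed
  have "(mult_at L P - 1) choose 2 = (if mult_at L P = 3 then 1 else 0) + 3 * (if mult_at L P = 4 then 1 else 0)"
    if "P \<in> crossings" for P
  proof -
    have "mult_at L P = 2 \<or> mult_at L P = 3 \<or> mult_at L P = 4"
      using le4[OF that] crossing_mult_at(1)[OF that] by linarith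
    then show ?thesis by (auto simp: choose_two)
  qed
  then have "excess L = (\<Sum>P\<in>crossings. (if mult_at L P = 3 then 1 else 0) + 3 * (if mult_at L P = 4 then 1 else 0))"
    unfolding excess_def by (intro sum.cong) auto
  also have "\<dots> = num_points L 3 + 3 * num_points L 4"
    using finite_crossings
    by (simp add: points sum.distrib flip: sum_distrib_left sum.inter_filter)
  finally show ?thesis by simp
qed

theorem proposition3p3:
  fixes L :: "(complex ^ 3) set set set" and d :: nat
  assumes "free_arrangement L"
    and "card L = d"
    and "d \<ge> 4"
    and "max_multiplicity L = 4"
  shows "(real d - 1) * (real d - 3) / 4 \<le> real (num_points L 3) + 3 * real (num_points L 4)"
proof -
  obtain a where a: "\<And>l. l \<in> L \<Longrightarrow> a l \<noteq> 0 \<and> proj_line (a l) = l"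
    and free: "free_graded_of_rank 2 (AR (\<Prod>l\<in>L. linear_form (a l)))"
    using assms(1) unfolding free_arrangement_def defining_equation_def by auto
  have "finite L" using assms(1) by (simp add: free_arrangement_def line_arrangement_def)
  then obtain p q u v n where "marked_lines L a p q u v n"
    using exists_marked_lines[of L a] a by blast
  then interpret marked_arrangement L a p q u v n
    using a by (auto intro!: marked_arrangement.intro marked_arrangement_axioms.intro)
  obtain B where B: "card B = 2" "\<And>b. b \<in> B \<Longrightarrow> \<exists>k. homogeneous_vec k b"
    "S3.independent B" "S3.span B = AR equation"
    using free unfolding free_graded_of_rank_def by blast
  obtain \<theta> \<eta> where B_eq: "B = {\<theta>, \<eta>}" "\<theta> \<noteq> \<eta>" using B(1) by (auto simp: card_2_iff)
  obtain b\<^sub>1 b\<^sub>2 where "homogeneous_vec b\<^sub>1 \<theta>" "homogeneous_vec b\<^sub>2 \<eta>"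
    using B(2) B_eq(1) by blast
  moreover have "L \<noteq> {}" using assms(2,3) by auto
  ultimately have "(real d - 1) * (real d - 3) / 4 \<le> real (excess L)"
    using excess_lower_bound[of \<theta> \<eta> b\<^sub>1 b\<^sub>2] B(3,4) B_eq assms(2) by simp
  also have "real (excess L) \<le> real (num_points L 3 + 3 * num_points L 4)"
    using excess_le_num_points[OF assms(4)] by (simp only: of_nat_le_iff)
  finally show ?thesis by simp
qed

end
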